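(* Let $p\ge 2$, $n>p$, and let $\mathbf X_1,\dots,\mathbf X_n$ be i.i.d. $N_p(\boldsymbol\theta,\boldsymbol\Sigma)$ with $\boldsymbol\Sigma\in\mathcal M$ unknown. Let $\mathcal C\subseteq\mathbb R^p$ be a closed convex cone such that $\mathcal U\subseteq\mathcal C\subseteq\mathcal H_p^*$ for some nonempty open set $\mathcal U\subseteq\mathbb R^p$. Let $0<\alpha<1$. Then the level-$\alpha$ likelihood ratio test (LRT) for $H_0:\boldsymbol\theta=\mathbf 0$ against $H_1:\boldsymbol\theta\in\mathcal C\setminus\{\mathbf 0\}$ is power-dominated by the level-$\alpha$ LRT for $H_0:\boldsymbol\theta=\mathbf 0$ against $H_1:\boldsymbol\theta\in\mathcal H_p^*\setminus\{\mathbf 0\}$. That is, if $d_{\mathcal C}>0$ and $d_{*}>0$ are the critical values with $\sup_{\boldsymbol\Sigma\in\mathcal M}P_{\mathbf 0,\boldsymbol\Sigma}\{L_{\mathcal C}\ge d_{\mathcal C}\}=\alpha$ and $\sup_{\boldsymbol\Sigma\in\mathcal M}P_{\mathbf 0,\boldsymbol\Sigma}\{L_{\mathcal H_p^*}\ge d_{*}\}=\alpha$, then $$P_{\boldsymbol\theta,\boldsymbol\Sigma}\{L_{\mathcal H_p^*}\ge d_{*}\}\ \ge\ P_{\boldsymbol\theta,\boldsymbol\Sigma}\{L_{\mathcal C}\ge d_{\mathcal C}\}\qquad\text{for all }\boldsymbol\theta\in\mathcal C\setminus\{\mathbf 0\},\ \boldsymbol\Sigma\in\mathcal M .$$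
   Context: $\mathcal M$ is the set of all $p\times p$ real symmetric positive definite matrices; $\mathcal H_p^*=\{\boldsymbol\theta\in\mathbb R^p:\theta_p\ge 0\}$. $\bar{\mathbf X}_n=n^{-1}\sum_i\mathbf X_i$ and $\mathbf S_n=\sum_i(\mathbf X_i-\bar{\mathbf X}_n)(\mathbf X_i-\bar{\mathbf X}_n)'$, which is positive definite with probability one. $P_{\boldsymbol\theta,\boldsymbol\Sigma}$ is the probability when the mean is $\boldsymbol\theta$ and the covariance $\boldsymbol\Sigma$. For positive definite $\mathbf A$, $\langle\mathbf x,\mathbf y\rangle_{\mathbf A}=\mathbf x'\mathbf A^{-1}\mathbf y$, $\|\cdot\|_{\mathbf A}$ is the induced norm, and $\pi_{\mathbf A}(\mathbf x;\mathcal C)$ is the orthogonal projection of $\mathbf x$ onto the closed convex cone $\mathcal C$ with respect to $\langle\cdot,\cdot\rangle_{\mathbf A}$. The LRT statistic for the alternative cone $\mathcal C$ is $$L_{\mathcal C}=\frac{\|\pi_{\mathbf S_n}(n^{1/2}\bar{\mathbf X}_n;\mathcal C)\|^2_{\mathbf S_n}}{1+\|n^{1/2}\bar{\mathbf X}_n-\pi_{\mathbf S_n}(n^{1/2}\bar{\mathbf X}_n;\mathcal C)\|^2_{\mathbf S_n}};$$ the LRT rejects $H_0$ when $L_{\mathcal C}\ge d$, and its level is defined by taking the supremum over all $\boldsymbol\Sigma\in\mathcal M$ of the null rejection probability. *)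

theory Defs
  imports "HOL-Analysis.Analysis" "HOL-Probability.Probability"
begin

definition spd_matrices :: "(real^'p^'p) set" where
  "spd_matrices = {A. transpose A = A \<and> (\<forall>x. x \<noteq> 0 \<longrightarrow> 0 < x \<bullet> (A *v x))}"

(* A finite linearly ordered index type is order-isomorphic to {1..p}; its maximum is the
   index p, so Hp_star is the set of vectors whose p-th coordinate is nonnegative. *)
definition Hp_star :: "(real^'p::{finite,linorder}) set" where
  "Hp_star = {\<theta>. 0 \<le> \<theta> $ Max UNIV}"

definition mvn_density :: "real^'p \<Rightarrow> real^'p^'p \<Rightarrow> real^'p \<Rightarrow> real" where
  "mvn_density \<theta> \<Sigma> x =
     1 / sqrt ((2 * pi) ^ CARD('p) * det \<Sigma>) * exp (- ((x - \<theta>) \<bullet> (matrix_inv \<Sigma> *v (x - \<theta>))) / 2)"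

definition iid_mvn ::
  "'a measure \<Rightarrow> nat \<Rightarrow> (nat \<Rightarrow> 'a \<Rightarrow> real^'p) \<Rightarrow> real^'p \<Rightarrow> real^'p^'p \<Rightarrow> bool" where
  "iid_mvn M n X \<theta> \<Sigma> \<longleftrightarrow>
     prob_space M \<and> prob_space.indep_vars M (\<lambda>_. borel) X {1..n} \<and>
     (\<forall>i\<in>{1..n}. distributed M lborel (X i) (\<lambda>x. ennreal (mvn_density \<theta> \<Sigma> x)))"

definition sample_mean :: "nat \<Rightarrow> (nat \<Rightarrow> real^'p) \<Rightarrow> real^'p" where
  "sample_mean n x = (1 / real n) *\<^sub>R (\<Sum>i=1..n. x i)"

definition outer_prod :: "real^'p \<Rightarrow> real^'p \<Rightarrow> real^'p^'p" where
  "outer_prod u v = (\<chi> i j. u $ i * v $ j)"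

definition scatter :: "nat \<Rightarrow> (nat \<Rightarrow> real^'p) \<Rightarrow> real^'p^'p" where
  "scatter n x = (\<Sum>i=1..n. outer_prod (x i - sample_mean n x) (x i - sample_mean n x))"

definition inner_wrt :: "real^'p^'p \<Rightarrow> real^'p \<Rightarrow> real^'p \<Rightarrow> real" where
  "inner_wrt A x y = x \<bullet> (matrix_inv A *v y)"

definition norm_wrt :: "real^'p^'p \<Rightarrow> real^'p \<Rightarrow> real" where
  "norm_wrt A x = sqrt (inner_wrt A x x)"

(* For positive definite A and nonempty closed convex C the nearest point exists and is unique. *)
definition proj_wrt :: "real^'p^'p \<Rightarrow> real^'p \<Rightarrow> (real^'p) set \<Rightarrow> real^'p" where
  "proj_wrt A x C = (THE y. y \<in> C \<and> (\<forall>z\<in>C. norm_wrt A (x - y) \<le> norm_wrt A (x - z)))"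

(* Norm and projection are only meaningful for a positive definite scatter matrix, which occurs
   with probability one when n > p. On the exceptional null event the statistic is set to 0;
   otherwise the rejection event could involve unspecified values and fail to be measurable,
   in which case its measure would be 0 by convention. *)
definition LRT :: "nat \<Rightarrow> (real^'p) set \<Rightarrow> (nat \<Rightarrow> real^'p) \<Rightarrow> real" where
  "LRT n C x =
     (let S = scatter n x; y = sqrt (real n) *\<^sub>R sample_mean n x; z = proj_wrt S y C in
      if S \<in> spd_matrices then (norm_wrt S z)\<^sup>2 / (1 + (norm_wrt S (y - z))\<^sup>2) else 0)"

(* P_{theta,Sigma}{L_C >= d}; the family P assigns to (theta, Sigma) the corresponding
   probability space. *)
definition LRT_power ::
  "(real^'p \<Rightarrow> real^'p^'p \<Rightarrow> 'a measure) \<Rightarrow> nat \<Rightarrow> (nat \<Rightarrow> 'a \<Rightarrow> real^'p) \<Rightarrow> (real^'p) set \<Rightarrow> real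
     \<Rightarrow> real^'p \<Rightarrow> real^'p^'p \<Rightarrow> real" where
  "LRT_power P n X C d \<theta> \<Sigma> = \<P>(\<omega> in P \<theta> \<Sigma>. d \<le> LRT n C (\<lambda>i. X i \<omega>))"

end

theory Submission
  imports Defs
begin

text \<open>
  Writing \<open>y\<close> for the scaled mean and \<open>S\<close> for the scatter matrix, \<open>L\<^sub>C\<close> is the maximum over \<open>w \<in> C\<close>
  of a quantity that depends only on \<open>S\<close>, \<open>y\<close> and \<open>w\<close>. Hence \<open>L\<^sub>C\<close> increases with \<open>C\<close>, and it
  suffices to show that the critical value of the half-space is at most that of \<open>C\<close>.
  A linear change of the sample turns a change of \<open>\<Sigma>\<close> into a change of the cone. The half-space
  is preserved by a suitable factor of \<open>\<Sigma>\<close>, so its null rejection probability does not depend on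
  \<open>\<Sigma>\<close>. The cone \<open>C\<close>, having an interior point \<open>u\<close>, can be spread out along the boundary
  hyperplane until its images exhaust the open half-space, so the size of the test based on \<open>C\<close> at
  \<open>d\<close> is at least the null probability of \<open>L\<^sub>H > d\<close>. If the critical value of the half-space were
  the larger one, the two levels could only agree if \<open>L\<^sub>H\<close> avoided the open interval between the
  critical values almost surely. But the samples with \<open>L\<^sub>H\<close> in this interval contain a nonempty
  open set, which has positive probability.
\<close>

section \<open>Matrices and positive definite forms\<close>

lemma matrix_inv_unique:
  fixes A B :: "real^'p^'p"
  assumes "A ** B = mat 1"
  shows "matrix_inv A = B"
proof -
  have BA: "B ** A = mat 1"
    using assms matrix_left_right_inverse by blast
  \<comment> \<open>\<open>matrix_inv\<close> is a choice of some two-sided inverse, so its property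
    is available only once \<open>B\<close> is known to be one.\<close>
  have "A ** matrix_inv A = mat 1"
    unfolding matrix_inv_def by (rule someI2[where a = B]) (use assms BA in auto)
  then have "B ** (A ** matrix_inv A) = B"
    by simp
  then show ?thesis
    by (simp add: matrix_mul_assoc BA)
qed

lemma
  fixes A :: "real^'p^'p"
  assumes "invertible A"
  shows matrix_inv_mult_right: "A ** matrix_inv A = mat 1"
    and matrix_inv_mult_left: "matrix_inv A ** A = mat 1"
  using assms matrix_inv_unique unfolding invertible_def by metis+

lemma matrix_inv_vector_cancel [simp]:
  fixes A :: "real^'p^'p"
  assumes "invertible A"
  shows "A *v (matrix_inv A *v x) = x" "matrix_inv A *v (A *v x) = x"
  using assms
  by (simp_all add: matrix_vector_mul_assoc matrix_inv_mult_left matrix_inv_mult_right)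

lemma bij_matrix_vector_mult:
  fixes A :: "real^'p^'p"
  assumes "invertible A"
  shows "bij ((*v) A)"
  by (rule o_bij[of "(*v) (matrix_inv A)"]) (use assms in \<open>auto simp: fun_eq_iff\<close>)

lemma inner_matrix_transpose:
  fixes A :: "real^'p^'p"
  shows "x \<bullet> (A *v y) = (transpose A *v x) \<bullet> y"
  by (simp add: dot_lmul_matrix)

lemma invertible_spd:
  assumes "S \<in> spd_matrices"
  shows "invertible S"
proof -
  have "x = 0" if "S *v x = 0" for x
    using assms that unfolding spd_matrices_def by force
  then show ?thesis
    using matrix_left_invertible_ker[of S] invertible_left_inverse[of S] by blast
qed

lemma spd_congruence:
  fixes A :: "real^'p^'p"
  assumes "S \<in> spd_matrices" "invertible A"
  shows "A ** S ** transpose A \<in> spd_matrices"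
  unfolding spd_matrices_def
proof (intro CollectI conjI allI impI)
  show "transpose (A ** S ** transpose A) = A ** S ** transpose A"
    using assms(1) by (simp add: matrix_transpose_mul spd_matrices_def matrix_mul_assoc)
  fix x :: "real^'p"
  assume "x \<noteq> 0"
  then have "transpose A *v x \<noteq> 0"
    using inj_matrix_vector_mult[OF transpose_invertible[OF assms(2)]]
    by (metis injD matrix_vector_mult_0_right)
  then show "0 < x \<bullet> (A ** S ** transpose A *v x)"
    using assms(1)
    by (simp add: inner_matrix_transpose[of x] spd_matrices_def flip: matrix_vector_mul_assoc)
qed

lemma mat_1_spd: "mat 1 \<in> spd_matrices"
  by (simp add: spd_matrices_def)

lemma factor_spd:
  fixes A :: "real^'p^'p"
  assumes "invertible A"
  shows "A ** transpose A \<in> spd_matrices"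
  using spd_congruence[OF mat_1_spd assms] by simp

text \<open>Gram--Schmidt is started from a coordinate axis so that the resulting factor of \<open>S\<close> preserves
  the half-space bounded by the corresponding coordinate hyperplane.\<close>
lemma spd_orthonormal_family:
  fixes S :: "real^'p^'p"
  assumes S: "S \<in> spd_matrices" and "finite I" "m \<notin> I"
  shows "\<exists>c v. 0 < c \<and> v m = axis m c \<and>
           (\<forall>i\<in>insert m I. \<forall>j\<in>insert m I. v i \<bullet> (S *v v j) = (if i = j then 1 else 0))"
  using assms(2,3)
proof (induction I)
  case empty
  let ?e = "axis m (1::real)"
  have pos: "0 < ?e \<bullet> (S *v ?e)"
    using S by (auto simp: spd_matrices_def axis_eq_0_iff)
  define a where "a = ?e \<bullet> (S *v ?e)"
  let ?c = "1 / sqrt a"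
  have a: "a > 0" using pos a_def by simp
  have ax: "axis m ?c = ?c *\<^sub>R ?e"
    by (simp add: axis_def vec_eq_iff)
  have "axis m ?c \<bullet> (S *v axis m ?c) = 1"
    using a unfolding ax
    by (simp add: matrix_vector_mult_scaleR a_def[symmetric] field_simps
      flip: power2_eq_square)
  then show ?case
    using a by (intro exI[of _ ?c] exI[of _ "\<lambda>_. axis m ?c"]) auto
next
  case (insert k I)
  then have "m \<notin> I" by simp
  from insert.IH[OF this] obtain c v where c: "0 < c" "v m = axis m c"
    and v: "\<And>i j. i \<in> insert m I \<Longrightarrow> j \<in> insert m I \<Longrightarrow>
             v i \<bullet> (S *v v j) = (if i = j then 1 else 0)"
    by blast
  have k: "k \<notin> insert m I" using insert by auto
  \<comment> \<open>There are fewer than p vectors \<open>S *v v j\<close>, because \<open>k\<close>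
    is missing, so some nonzero \<open>x\<close> is orthogonal to all of them. Euclidean
    orthogonality to \<open>S *v v j\<close> is orthogonality to \<open>v j\<close> in the form of
    \<open>S\<close>.\<close>
  let ?T = "(\<lambda>j. S *v v j) ` insert m I"
  have "dim ?T \<le> card ?T"
    by (rule dim_le_card') (use insert in auto)
  also have "\<dots> \<le> card (insert m I)"
    by (rule card_image_le) (use insert in auto)
  also have "\<dots> < CARD('p)"
    by (rule psubset_card_mono) (use k in auto)
  finally have "dim ?T < DIM(real^'p)"
    by simp
  then obtain x where x0: "x \<noteq> 0" and x: "\<And>y. y \<in> span ?T \<Longrightarrow> orthogonal x y"
    using orthogonal_to_subspace_exists[of ?T] by blast
  define a where "a = x \<bullet> (S *v x)"
  have a: "a > 0" using S x0 by (auto simp: spd_matrices_def a_def)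
  have x1: "x \<bullet> (S *v v j) = 0" if "j \<in> insert m I" for j
    using x[of "S *v v j"] that by (auto simp: orthogonal_def span_base)
  have x2: "v j \<bullet> (S *v x) = 0" if "j \<in> insert m I" for j
    using S x1[OF that] by (simp add: inner_matrix_transpose[of "v j"] spd_matrices_def inner_commute)
  define w where "w = v(k := (1 / sqrt a) *\<^sub>R x)"
  have wk: "w k \<bullet> (S *v w k) = 1"
    using a by (simp add: w_def matrix_vector_mult_scaleR a_def[symmetric] field_simps
        flip: power2_eq_square)
  have "w i \<bullet> (S *v w j) = (if i = j then 1 else 0)"
    if "i \<in> insert m (insert k I)" "j \<in> insert m (insert k I)" for i j
  proof -
    consider "i = k" "j = k" | "i = k" "j \<noteq> k" | "i \<noteq> k" "j = k" | "i \<noteq> k" "j \<noteq> k"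
      by blast
    then show ?thesis
    proof cases
      case 1 then show ?thesis using wk by simp
    next
      case 2 then show ?thesis using x1[of j] that by (auto simp: w_def)
    next
      case 3 then show ?thesis using x2[of i] that
        by (auto simp: w_def matrix_vector_mult_scaleR)
    next
      case 4 then show ?thesis using v[of i j] that by (auto simp: w_def)
    qed
  qed
  moreover have "w m = axis m c"
    using k c by (auto simp: w_def)
  ultimately show ?case
    using c(1) by blast
qed

text \<open>If the columns of \<open>V\<close> are orthonormal for the form of \<open>S\<close>,
  then V V' is the inverse of \<open>S\<close>, and \<open>S ** V\<close> is a factor because S V V'
  S = S. Column \<open>m\<close> of \<open>V\<close> lies on a coordinate axis, which makes row
  \<open>m\<close> of the factor a positive multiple of that axis.\<close>

lemma spd_factorization:
  fixes S :: "real^'p^'p"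
  assumes S: "S \<in> spd_matrices"
  obtains B c where "invertible B" "B ** transpose B = S" "0 < c" "\<And>x. (B *v x) $ m = c * x $ m"
proof -
  have "insert m (UNIV - {m}) = UNIV" by auto
  then obtain c v where c: "0 < c" and vm: "v m = axis m c"
    and v: "\<And>i j. v i \<bullet> (S *v v j) = (if i = j then 1 else 0)"
    using spd_orthonormal_family[OF S, of "UNIV - {m}" m] by auto
  define V :: "real^'p^'p" where "V = (\<chi> i j. v j $ i)"
  have St: "transpose S = S" using S by (simp add: spd_matrices_def)
  have V_axis: "V *v axis j 1 = v j" for j
    by (simp add: V_def vec_eq_iff matrix_vector_mult_def axis_def if_distrib cong: if_cong)
  have "(transpose V ** S ** V) $ i $ j = mat 1 $ i $ j" for i j
  proof -
    have "(transpose V ** S ** V) $ i $ j = axis i 1 \<bullet> ((transpose V ** S ** V) *v axis j 1)"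
      by (simp add: inner_axis' matrix_vector_mult_basis column_def)
    also have "\<dots> = v i \<bullet> (S *v v j)"
      by (simp only: matrix_vector_mul_assoc[symmetric] V_axis inner_matrix_transpose[of "axis i 1"]
          transpose_transpose)
    finally show ?thesis
      by (simp add: v mat_def)
  qed
  then have VSV: "transpose V ** S ** V = mat 1"
    by (simp add: vec_eq_iff)
  then have VVS: "V ** (transpose V ** S) = mat 1"
    using matrix_left_right_inverse by blast
  let ?B = "S ** V"
  have Bt: "transpose ?B = transpose V ** S"
    by (simp add: matrix_transpose_mul St)
  show ?thesis
  proof
    show "invertible ?B"
      using VSV invertible_left_inverse[of ?B] by (metis matrix_mul_assoc)
    have "?B ** transpose ?B = S ** (V ** (transpose V ** S))"
      by (simp add: Bt matrix_mul_assoc)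
    then show "?B ** transpose ?B = S" by (simp add: VVS)
    show "0 < 1 / c" using c by simp
    fix x
    \<comment> \<open>\<open>transpose ?B\<close> inverts \<open>V\<close>, and \<open>V\<close>
      stretches the axis by \<open>c\<close>; hence the axis is an eigenvector of
      \<open>transpose ?B\<close> for 1/c, which determines row \<open>m\<close> of
      \<open>?B\<close>.\<close>
    have "axis m 1 = transpose ?B *v (V *v axis m 1)"
      using VSV by (simp add: Bt matrix_vector_mul_assoc)
    also have "\<dots> = c *\<^sub>R (transpose ?B *v axis m 1)"
    proof -
      have "axis m c = c *\<^sub>R axis m 1" by (simp add: axis_def vec_eq_iff)
      then show ?thesis by (simp add: V_axis vm matrix_vector_mult_scaleR)
    qed
    finally have "transpose ?B *v axis m 1 = (1 / c) *\<^sub>R axis m 1"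
      using c by (metis divide_inverse mult_1 scaleR_scaleR
          right_inverse less_irrefl scaleR_one mult.commute)
    then have "axis m 1 \<bullet> (?B *v x) = (1 / c) *\<^sub>R axis m 1 \<bullet> x"
      by (simp only: inner_matrix_transpose)
    then show "(?B *v x) $ m = 1 / c * x $ m"
      by (simp add: inner_axis')
  qed
qed

lemma matrix_inv_factor:
  fixes B :: "real^'p^'p"
  assumes "invertible B"
  shows "matrix_inv (B ** transpose B) = transpose (matrix_inv B) ** matrix_inv B"
proof (rule matrix_inv_unique)
  have "B ** transpose B ** (transpose (matrix_inv B) ** matrix_inv B)
      = B ** (transpose B ** transpose (matrix_inv B)) ** matrix_inv B"
    by (simp add: matrix_mul_assoc)
  also have "transpose B ** transpose (matrix_inv B) = mat 1"
    using assms by (simp add: matrix_inv_mult_left flip: matrix_transpose_mul)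
  finally show "B ** transpose B ** (transpose (matrix_inv B) ** matrix_inv B) = mat 1"
    using assms by (simp add: matrix_inv_mult_right)
qed

lemma inner_wrt_factor:
  fixes B :: "real^'p^'p"
  assumes "invertible B"
  shows "inner_wrt (B ** transpose B) x y = (matrix_inv B *v x) \<bullet> (matrix_inv B *v y)"
  unfolding inner_wrt_def matrix_inv_factor[OF assms] matrix_vector_mul_assoc[symmetric]
    inner_matrix_transpose[of x] transpose_transpose ..

lemma norm_wrt_factor:
  fixes B :: "real^'p^'p"
  assumes "invertible B"
  shows "norm_wrt (B ** transpose B) x = norm (matrix_inv B *v x)"
  by (simp add: norm_wrt_def inner_wrt_factor[OF assms] norm_eq_sqrt_inner)

text \<open>If S = B B', then \<open>A ** B\<close> is a factor of the congruent matrix, and both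
  sides are the Euclidean norm of \<open>matrix_inv B *v x\<close>.\<close>

lemma norm_wrt_congruence:
  fixes A :: "real^'p^'p"
  assumes "S \<in> spd_matrices" "invertible A"
  shows "norm_wrt (A ** S ** transpose A) (A *v x) = norm_wrt S x"
proof -
  obtain B :: "real^'p^'p" where B: "invertible B" "B ** transpose B = S"
    using spd_factorization[OF assms(1)] by blast
  have AB: "invertible (A ** B)"
    using assms(2) B(1) by (rule invertible_mult)
  have "A ** S ** transpose A = (A ** B) ** transpose (A ** B)"
    by (simp add: matrix_transpose_mul matrix_mul_assoc flip: B(2))
  moreover have "matrix_inv (A ** B) *v (A *v x) = matrix_inv B *v x"
  proof -
    have "A *v x = (A ** B) *v (matrix_inv B *v x)"
      using B(1) by (simp flip: matrix_vector_mul_assoc)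
    then show ?thesis using AB by simp
  qed
  ultimately show ?thesis
    by (simp add: norm_wrt_factor AB B(1) flip: B(2))
qed

section \<open>The likelihood ratio statistic as a maximum over the cone\<close>

definition root_mean :: "nat \<Rightarrow> (nat \<Rightarrow> real^'p) \<Rightarrow> real^'p" where
  "root_mean n x = sqrt (real n) *\<^sub>R sample_mean n x"

text \<open>Equals \<open>(\<parallel>y\<parallel>\<^sup>2 - \<parallel>y - w\<parallel>\<^sup>2) / (1 + \<parallel>y - w\<parallel>\<^sup>2)\<close>, so that the LRT statistic of a cone is the
  maximum of \<open>fit\<close> over the cone: at the projection \<open>z\<close> of \<open>y\<close> the numerator is \<open>\<parallel>z\<parallel>\<^sup>2\<close>.\<close>
definition fit :: "real^'p^'p \<Rightarrow> real^'p \<Rightarrow> real^'p \<Rightarrow> real" where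
  "fit S y w = (1 + (norm_wrt S y)\<^sup>2) / (1 + (norm_wrt S (y - w))\<^sup>2) - 1"

definition closed_convex_cone :: "(real^'p) set \<Rightarrow> bool" where
  "closed_convex_cone C \<longleftrightarrow> closed C \<and> convex C \<and> cone C \<and> C \<noteq> {}"

lemma fit_antimono:
  assumes "norm_wrt S (y - z) \<le> norm_wrt S (y - w)" "0 \<le> norm_wrt S (y - z)"
  shows "fit S y w \<le> fit S y z"
proof -
  have "(norm_wrt S (y - z))\<^sup>2 \<le> (norm_wrt S (y - w))\<^sup>2"
    using assms by (rule power_mono)
  then show ?thesis
    unfolding fit_def by (intro diff_right_mono divide_left_mono mult_pos_pos add_pos_nonneg) auto
qed

lemma continuous_on_fit: "continuous_on UNIV (fit S y)"
proof -
  have "1 + (norm_wrt S (y - w))\<^sup>2 \<noteq> 0" for w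
    by (metis add_pos_nonneg less_irrefl zero_le_power2 zero_less_one)
  then show ?thesis
    unfolding fit_def norm_wrt_def inner_wrt_def
    by (intro continuous_intros ballI linear_continuous_on_compose[OF _ matrix_vector_mul_linear])
qed

text \<open>A cone contains 0 and 2z along with the closest point z; the obtuse-angle inequality at
  these two points bounds the same inner product from both sides.\<close>

lemma closest_point_cone_orthogonal:
  fixes C :: "'a::euclidean_space set"
  assumes "closed C" "convex C" "cone C" "C \<noteq> {}"
  shows "(a - closest_point C a) \<bullet> closest_point C a = 0"
proof -
  let ?z = "closest_point C a"
  have z: "?z \<in> C"
    using assms closest_point_in_set by blast
  then have "c *\<^sub>R ?z \<in> C" if "0 \<le> c" for c
    using assms(3) that by (simp add: cone_def)
  then have "0 *\<^sub>R ?z \<in> C" "2 *\<^sub>R ?z \<in> C"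
    by (metis order_refl, metis zero_le_numeral)
  then have "(a - ?z) \<bullet> (0 *\<^sub>R ?z - ?z) \<le> 0" "(a - ?z) \<bullet> (2 *\<^sub>R ?z - ?z) \<le> 0"
    using closest_point_dot[OF assms(2,1)] by blast+
  then show ?thesis
    by (simp add: scaleR_2 inner_simps)
qed

lemma closed_convex_cone_vimage:
  fixes A :: "real^'p^'p"
  assumes "closed_convex_cone C" "invertible A"
  shows "closed_convex_cone ((*v) A -` C)"
  unfolding closed_convex_cone_def
proof (intro conjI)
  have lin: "linear ((*v) A)" by (rule matrix_vector_mul_linear)
  show "closed ((*v) A -` C)"
    using assms(1) linear_continuous_at[OF lin[unfolded linear_conv_bounded_linear]]
    by (intro continuous_closed_vimage) (auto simp: closed_convex_cone_def)
  show "convex ((*v) A -` C)"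
    using assms(1) lin by (intro convex_linear_vimage) (auto simp: closed_convex_cone_def)
  show "cone ((*v) A -` C)"
    using assms(1) by (auto simp: closed_convex_cone_def cone_def matrix_vector_mult_scaleR)
  show "(*v) A -` C \<noteq> {}"
    using assms bij_matrix_vector_mult[OF assms(2)]
    by (metis bij_is_surj closed_convex_cone_def image_vimage_eq inf_top.right_neutral image_empty)
qed

text \<open>If S = B B', then \<open>matrix_inv B\<close> is an isometry from the norm of
  \<open>S\<close> to the Euclidean norm and carries \<open>C\<close> to another closed convex cone.
  Existence and uniqueness of the nearest point come from there, and the Pythagorean identity from
  orthogonality in a cone.\<close>

lemma proj_wrt_cone:
  fixes C :: "(real^'p) set" and y :: "real^'p"
  assumes S: "S \<in> spd_matrices" and C: "closed_convex_cone C"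
  defines "z \<equiv> proj_wrt S y C"
  shows "z \<in> C"
    and "\<And>w. w \<in> C \<Longrightarrow> norm_wrt S (y - z) \<le> norm_wrt S (y - w)"
    and "(norm_wrt S y)\<^sup>2 = (norm_wrt S z)\<^sup>2 + (norm_wrt S (y - z))\<^sup>2"
proof -
  obtain B :: "real^'p^'p" where B: "invertible B" "B ** transpose B = S"
    using spd_factorization[OF S] by blast
  let ?R = "matrix_inv B"
  let ?D = "(*v) B -` C"
  have D: "closed ?D" "convex ?D" "cone ?D" "?D \<noteq> {}"
    using closed_convex_cone_vimage[OF C B(1)] by (auto simp: closed_convex_cone_def)
  have N: "norm_wrt S x = norm (?R *v x)" for x
    using norm_wrt_factor[OF B(1)] B(2) by simp
  have dist: "norm_wrt S (y - x) = dist (?R *v y) (?R *v x)" for x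
    by (simp add: N dist_norm matrix_vector_mult_diff_distrib)
  let ?c = "closest_point ?D (?R *v y)"
  have c: "?c \<in> ?D"
    using D closest_point_in_set by blast
  have inD: "?R *v x \<in> ?D \<longleftrightarrow> x \<in> C" for x
    using B(1) by simp
  have zc: "z = B *v ?c"
    unfolding z_def proj_wrt_def
  proof (rule the_equality)
    show "B *v ?c \<in> C \<and> (\<forall>w\<in>C. norm_wrt S (y - B *v ?c) \<le> norm_wrt S (y - w))"
    proof (intro conjI ballI)
      show "B *v ?c \<in> C" using c by simp
      fix w assume "w \<in> C"
      then have "?R *v w \<in> ?D" using inD by blast
      then show "norm_wrt S (y - B *v ?c) \<le> norm_wrt S (y - w)"
        unfolding dist using closest_point_le[OF D(1)] B(1) by simp
    qed
    fix x assume x: "x \<in> C \<and> (\<forall>w\<in>C. norm_wrt S (y - x) \<le> norm_wrt S (y - w))"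
    have "?R *v x = ?c"
    proof (rule closest_point_unique[OF D(2,1)])
      show "?R *v x \<in> ?D" using x inD by blast
      show "\<forall>w\<in>?D. dist (?R *v y) (?R *v x) \<le> dist (?R *v y) w"
      proof
        fix w assume "w \<in> ?D"
        then have "norm_wrt S (y - x) \<le> norm_wrt S (y - B *v w)" using x by simp
        then show "dist (?R *v y) (?R *v x) \<le> dist (?R *v y) w"
          using B(1) by (simp add: dist)
      qed
    qed
    then show "x = B *v ?c"
      using B(1) by (metis matrix_inv_vector_cancel(1))
  qed
  have Rz: "?R *v z = ?c" using B(1) by (simp add: zc)
  show "z \<in> C" using c by (simp add: zc)
  show "norm_wrt S (y - z) \<le> norm_wrt S (y - w)" if "w \<in> C" for w
    using that closest_point_le[OF D(1)] inD unfolding dist Rz by blast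
  have "(?R *v y - ?c) \<bullet> ?c = 0"
    by (rule closest_point_cone_orthogonal[OF D])
  then have "(norm (?c + (?R *v y - ?c)))\<^sup>2 = (norm ?c)\<^sup>2 + (norm (?R *v y - ?c))\<^sup>2"
    by (intro norm_add_Pythagorean) (simp add: orthogonal_def inner_commute)
  then show "(norm_wrt S y)\<^sup>2 = (norm_wrt S z)\<^sup>2 + (norm_wrt S (y - z))\<^sup>2"
    by (simp add: N matrix_vector_mult_diff_distrib Rz)
qed

lemma norm_wrt_nonneg:
  fixes x :: "real^'p"
  assumes "S \<in> spd_matrices"
  shows "0 \<le> norm_wrt S x"
proof -
  obtain B :: "real^'p^'p" where B: "invertible B" "B ** transpose B = S"
    using spd_factorization[OF assms] by blast
  then show ?thesis
    using norm_wrt_factor[OF B(1)] by simp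
qed

lemma LRT_max_fit:
  fixes C :: "(real^'p) set"
  assumes S: "scatter n x \<in> spd_matrices" and C: "closed_convex_cone C"
  shows "\<exists>z\<in>C. LRT n C x = fit (scatter n x) (root_mean n x) z"
    and "\<And>w. w \<in> C \<Longrightarrow> fit (scatter n x) (root_mean n x) w \<le> LRT n C x"
proof -
  let ?S = "scatter n x" and ?y = "root_mean n x"
  let ?z = "proj_wrt ?S ?y C"
  note z = proj_wrt_cone[OF S C, where y = ?y]
  have "1 + (norm_wrt ?S (?y - ?z))\<^sup>2 \<noteq> 0"
    by (metis add_pos_nonneg less_irrefl zero_le_power2 zero_less_one)
  then have eq: "LRT n C x = fit ?S ?y ?z"
    using S z(3) by (simp add: LRT_def Let_def fit_def root_mean_def[symmetric] divide_simps)
  then show "\<exists>z\<in>C. LRT n C x = fit ?S ?y z"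
    using z(1) by blast
  show "fit ?S ?y w \<le> LRT n C x" if "w \<in> C" for w
    unfolding eq using z(2)[OF that] norm_wrt_nonneg[OF S] by (rule fit_antimono)
qed

lemma LRT_pos_imp_spd:
  assumes "0 < LRT n C x"
  shows "scatter n x \<in> spd_matrices"
  using assms by (auto simp: LRT_def Let_def split: if_splits)

text \<open>Positivity of \<open>d\<close> rules out the default value 0 of \<open>LRT\<close>, so
  reaching \<open>d\<close> forces a positive definite scatter matrix. The weak inequality can be
  tested at a single \<open>w\<close> because the maximum of \<open>fit\<close> is attained.\<close>

lemma LRT_ge_iff:
  assumes "closed_convex_cone C" "0 < d"
  shows "d \<le> LRT n C x \<longleftrightarrow>
           scatter n x \<in> spd_matrices \<and> (\<exists>w\<in>C. d \<le> fit (scatter n x) (root_mean n x) w)"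
  using LRT_max_fit[OF _ assms(1), of n x] LRT_pos_imp_spd[of n C x] assms(2)
  by (smt (verit))

lemma LRT_greater_iff:
  assumes "closed_convex_cone C" "0 < d"
  shows "d < LRT n C x \<longleftrightarrow>
           scatter n x \<in> spd_matrices \<and> (\<exists>w\<in>C. d < fit (scatter n x) (root_mean n x) w)"
  using LRT_max_fit[OF _ assms(1), of n x] LRT_pos_imp_spd[of n C x] assms(2)
  by (smt (verit))

section \<open>Behaviour of mean, scatter matrix and statistic under linear maps and
  translations\<close>

lemma outer_prod_mult: "outer_prod u v *v w = (v \<bullet> w) *\<^sub>R u"
  by (simp add: vec_eq_iff outer_prod_def matrix_vector_mult_def inner_vec_def sum_distrib_left
      sum_distrib_right mult_ac)

lemma matrix_vector_mult_sum_left: "(\<Sum>i\<in>I. f i) *v (w::real^'p) = (\<Sum>i\<in>I. f i *v w)"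
  by (induction I rule: infinite_finite_induct)
    (simp_all add: matrix_vector_mult_add_rdistrib)

lemma scatter_mult:
  "scatter n x *v w = (\<Sum>i=1..n. ((x i - sample_mean n x) \<bullet> w) *\<^sub>R (x i - sample_mean n x))"
  by (simp add: scatter_def matrix_vector_mult_sum_left outer_prod_mult)

text \<open>The form of the scatter matrix at \<open>w\<close> is the sum of the squared inner
  products of \<open>w\<close> with the residuals. If it vanishes, \<open>w\<close> is orthogonal to
  every residual and so lies in the kernel. The determinant condition is the one suited to
  measurability and openness.\<close>

lemma scatter_spd_iff: "scatter n x \<in> spd_matrices \<longleftrightarrow> det (scatter n x) \<noteq> 0"
proof
  assume "scatter n x \<in> spd_matrices"
  then show "det (scatter n x) \<noteq> 0"
    using invertible_spd invertible_det_nz by blast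
next
  let ?r = "\<lambda>i. x i - sample_mean n x"
  assume det: "det (scatter n x) \<noteq> 0"
  have "transpose (scatter n x) = scatter n x"
    by (simp add: vec_eq_iff transpose_def scatter_def outer_prod_def mult.commute)
  moreover have "0 < w \<bullet> (scatter n x *v w)" if "w \<noteq> 0" for w
  proof (rule ccontr)
    have eq: "w \<bullet> (scatter n x *v w) = (\<Sum>i=1..n. (?r i \<bullet> w)\<^sup>2)"
      by (simp add: scatter_mult inner_sum_right power2_eq_square inner_commute)
    moreover assume "\<not> 0 < w \<bullet> (scatter n x *v w)"
    ultimately have "(\<Sum>i=1..n. (?r i \<bullet> w)\<^sup>2) = 0"
      by (metis antisym not_less sum_nonneg zero_le_power2)
    then have "\<forall>i\<in>{1..n}. ?r i \<bullet> w = 0"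
      by (subst (asm) sum_nonneg_eq_0_iff) auto
    then have "scatter n x *v w = 0"
      by (simp add: scatter_mult)
    then show False
      using that det invertible_det_nz matrix_left_invertible_ker invertible_left_inverse by blast
  qed
  ultimately show "scatter n x \<in> spd_matrices"
    by (simp add: spd_matrices_def)
qed

lemma sample_mean_linear:
  fixes A :: "real^'p^'p"
  shows "sample_mean n (\<lambda>i. A *v x i) = A *v sample_mean n x"
  by (simp add: sample_mean_def matrix_vector_mult_scaleR linear_sum[OF matrix_vector_mul_linear])

lemma root_mean_linear:
  fixes A :: "real^'p^'p"
  shows "root_mean n (\<lambda>i. A *v x i) = A *v root_mean n x"
  by (simp add: root_mean_def sample_mean_linear matrix_vector_mult_scaleR)

lemma scatter_linear:
  fixes A :: "real^'p^'p"
  shows "scatter n (\<lambda>i. A *v x i) = A ** scatter n x ** transpose A"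
proof -
  have "scatter n (\<lambda>i. A *v x i) *v w = (A ** scatter n x ** transpose A) *v w" for w
  proof -
    have "(A ** scatter n x ** transpose A) *v w = A *v (scatter n x *v (transpose A *v w))"
      by (simp only: matrix_vector_mul_assoc matrix_mul_assoc)
    also have "\<dots> = (\<Sum>i=1..n. ((x i - sample_mean n x) \<bullet> (transpose A *v w)) *\<^sub>R
                        (A *v (x i - sample_mean n x)))"
      by (simp only: scatter_mult linear_sum[OF matrix_vector_mul_linear] matrix_vector_mult_scaleR)
    also have "\<dots> = scatter n (\<lambda>i. A *v x i) *v w"
      by (simp only: scatter_mult sample_mean_linear inner_matrix_transpose transpose_transpose
          matrix_vector_mult_diff_distrib)
    finally show ?thesis by simp
  qed
  then show ?thesis
    by (simp add: matrix_eq)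
qed

lemma sample_mean_translate:
  "0 < n \<Longrightarrow> sample_mean n (\<lambda>i. x i + c) = sample_mean n x + c"
  by (simp add: sample_mean_def sum.distrib scaleR_add_right sum_constant_scaleR
      del: sum_constant)

lemma scatter_translate: "0 < n \<Longrightarrow> scatter n (\<lambda>i. x i + c) = scatter n x"
  by (simp add: scatter_def sample_mean_translate)

lemma fit_congruence:
  fixes A :: "real^'p^'p"
  assumes "S \<in> spd_matrices" "invertible A"
  shows "fit (A ** S ** transpose A) (A *v y) (A *v w) = fit S y w"
  using norm_wrt_congruence[OF assms]
  by (simp add: fit_def flip: matrix_vector_mult_diff_distrib)

text \<open>\<open>fit\<close> is unchanged when \<open>A\<close> acts on scatter matrix, mean and
  candidate point alike, so maximising over \<open>C\<close> for the transformed sample is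
  maximising over the preimage of \<open>C\<close> for the original one.\<close>

lemma LRT_linear_ge_iff:
  fixes A :: "real^'p^'p"
  assumes C: "closed_convex_cone C" and A: "invertible A" and d: "0 < d"
  shows "d \<le> LRT n C (\<lambda>i. A *v x i) \<longleftrightarrow> d \<le> LRT n ((*v) A -` C) x"
proof -
  have spd: "scatter n (\<lambda>i. A *v x i) \<in> spd_matrices \<longleftrightarrow> scatter n x \<in> spd_matrices"
    using A unfolding scatter_spd_iff
    by (simp add: scatter_linear det_mul invertible_det_nz)
  have "(\<exists>w\<in>C. d \<le> fit (scatter n (\<lambda>i. A *v x i)) (root_mean n (\<lambda>i. A *v x i)) w)
    \<longleftrightarrow> (\<exists>w\<in>(*v) A -` C. d \<le> fit (scatter n x) (root_mean n x) w)"
    if "scatter n x \<in> spd_matrices"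
  proof -
    have "(\<exists>w\<in>C. d \<le> fit (scatter n (\<lambda>i. A *v x i)) (root_mean n (\<lambda>i. A *v x i)) w)
      \<longleftrightarrow> (\<exists>w. A *v w \<in> C \<and>
            d \<le> fit (scatter n (\<lambda>i. A *v x i)) (root_mean n (\<lambda>i. A *v x i)) (A *v w))"
      using A by (metis matrix_inv_vector_cancel(1))
    then show ?thesis
      by (auto simp: scatter_linear root_mean_linear fit_congruence[OF that A])
  qed
  then show ?thesis
    using spd LRT_ge_iff[OF C d] LRT_ge_iff[OF closed_convex_cone_vimage[OF C A] d] by blast
qed

lemma LRT_cong:
  assumes "\<And>i. i \<in> {1..n} \<Longrightarrow> x i = y i"
  shows "LRT n C x = LRT n C y"
proof -
  have "sample_mean n x = sample_mean n y"
    using assms by (simp add: sample_mean_def)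
  moreover from this have "scatter n x = scatter n y"
    using assms by (simp add: scatter_def)
  ultimately show ?thesis
    by (simp add: LRT_def)
qed

lemma LRT_mono:
  assumes "closed_convex_cone C" "closed_convex_cone D" "C \<subseteq> D" "0 < d" "d \<le> LRT n C x"
  shows "d \<le> LRT n D x"
  using assms by (auto simp: LRT_ge_iff)

section \<open>The half-space and its approximation by preimages of the cone\<close>

lemma closed_convex_cone_Hp_star: "closed_convex_cone Hp_star" (is "closed_convex_cone ?H")
  unfolding closed_convex_cone_def
proof (intro conjI)
  show "closed ?H"
    unfolding Hp_star_def by (intro closed_Collect_le continuous_intros)
  show "convex ?H" "cone ?H"
    by (auto simp: Hp_star_def convex_def cone_def)
  have "0 \<in> ?H" by (simp add: Hp_star_def)
  then show "?H \<noteq> {}" by blast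
qed

text \<open>A witness of the strict inequality may lie on the bounding hyperplane, which the
  approximating cones need not reach. By continuity of \<open>fit\<close> it can be pushed into the
  open half-space without losing the inequality.\<close>

lemma LRT_Hp_star_greaterD:
  assumes "0 < d" "d < LRT n Hp_star x"
  shows "\<exists>w. 0 < w $ Max UNIV \<and> d < fit (scatter n x) (root_mean n x) w"
proof -
  let ?f = "fit (scatter n x) (root_mean n x)"
  let ?e = "axis (Max UNIV) 1"
  obtain w where w: "0 \<le> w $ Max UNIV" "d < ?f w"
    using assms LRT_greater_iff[OF closed_convex_cone_Hp_star assms(1)] by (auto simp: Hp_star_def)
  have "continuous_on UNIV (\<lambda>t::real. ?f (w + t *\<^sub>R ?e))"
    by (rule continuous_on_compose2[OF continuous_on_fit]) (auto intro!: continuous_intros)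
  then have "((\<lambda>t::real. ?f (w + t *\<^sub>R ?e)) \<longlongrightarrow> ?f (w + 0 *\<^sub>R ?e)) (at 0 within UNIV)"
    unfolding continuous_on_def by blast
  then have "((\<lambda>t::real. ?f (w + t *\<^sub>R ?e)) \<longlongrightarrow> ?f (w + 0 *\<^sub>R ?e)) (at_right 0)"
    by (rule tendsto_within_subset) simp
  then have "eventually (\<lambda>t::real. d < ?f (w + t *\<^sub>R ?e)) (at_right 0)"
    by (rule order_tendstoD(1)) (use w in simp)
  then have "eventually (\<lambda>t::real. d < ?f (w + t *\<^sub>R ?e) \<and> 0 < t) (at_right 0)"
    by (rule eventually_conj) (simp add: eventually_at_filter)
  then obtain t where "d < ?f (w + t *\<^sub>R ?e)" "0 < t"
    by (auto dest: eventually_happens)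
  then show ?thesis
    using w(1) by (intro exI[of _ "w + t *\<^sub>R ?e"]) auto
qed

text \<open>For nonzero \<open>u $ m\<close>, the vector \<open>y\<close> is split into a multiple
  of \<open>u\<close> and a part in the hyperplane where coordinate \<open>m\<close> vanishes; only
  the hyperplane part is scaled by \<open>t\<close>.\<close>

definition squeeze :: "real^'p \<Rightarrow> 'p \<Rightarrow> real \<Rightarrow> real^'p \<Rightarrow> real^'p" where
  "squeeze u m t y = t *\<^sub>R (y - (y $ m / u $ m) *\<^sub>R u) + (y $ m / u $ m) *\<^sub>R u"

lemma linear_squeeze: "linear (squeeze u m t)"
  by (rule linearI) (simp_all add: squeeze_def algebra_simps add_divide_distrib)

lemma squeeze_squeeze: "u $ m \<noteq> 0 \<Longrightarrow> squeeze u m s (squeeze u m t y) = squeeze u m (s * t) y"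
  by (simp add: squeeze_def algebra_simps)

lemma invertible_squeeze:
  assumes "u $ m \<noteq> 0" "t \<noteq> 0"
  shows "invertible (matrix (squeeze u m t))"
proof -
  have "squeeze u m s \<circ> squeeze u m (1 / s) = id" if "s \<noteq> 0" for s
    using squeeze_squeeze[OF assms(1)] that by (auto simp: fun_eq_iff squeeze_def)
  from this[of t] this[of "1 / t"] assms(2) show ?thesis
    using linear_squeeze[of u m] by (auto simp: matrix_invertible)
qed

text \<open>The preimages of the cone under \<open>squeeze u m t\<close> fill up the open half-space as \<open>t\<close> tends
  to 0, because \<open>squeeze u m t y\<close> then tends to a positive multiple of the interior point \<open>u\<close>.\<close>
lemma eventually_squeeze_in_cone:
  assumes "open U" "u \<in> U" "U \<subseteq> C" "cone C" "0 < u $ m" "0 < y $ m"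
  shows "eventually (\<lambda>k. squeeze u m (1 / real (Suc k)) y \<in> C) sequentially"
proof -
  define c where "c = y $ m / u $ m"
  have c: "0 < c" using assms by (simp add: c_def)
  let ?g = "\<lambda>k. (1 / c) *\<^sub>R squeeze u m (1 / real (Suc k)) y"
  have "(\<lambda>k. 1 / real (Suc k)) \<longlonglongrightarrow> 0"
    using LIMSEQ_inverse_real_of_nat by (simp add: inverse_eq_divide)
  then have "?g \<longlonglongrightarrow> (1 / c) *\<^sub>R (0 *\<^sub>R (y - c *\<^sub>R u) + c *\<^sub>R u)"
    unfolding squeeze_def c_def[symmetric] by (intro tendsto_intros)
  then have "?g \<longlonglongrightarrow> u" using c by simp
  then have "eventually (\<lambda>k. ?g k \<in> U) sequentially"
    using assms(1,2) by (rule topological_tendstoD)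
  then show ?thesis
  proof (rule eventually_mono)
    fix k assume "?g k \<in> U"
    then have "c *\<^sub>R ?g k \<in> C"
      using assms(3,4) c unfolding cone_def by (meson less_imp_le subsetD)
    then show "squeeze u m (1 / real (Suc k)) y \<in> C" using c by simp
  qed
qed

text \<open>Otherwise a short step against the axis \<open>Max UNIV\<close> would stay in
  \<open>U\<close> but leave the half-space.\<close>

lemma open_subset_Hp_star_pos:
  assumes "open U" "u \<in> U" "U \<subseteq> Hp_star"
  shows "0 < u $ Max UNIV"
proof (rule ccontr)
  assume neg: "\<not> 0 < u $ Max UNIV"
  obtain e where e: "0 < e" "ball u e \<subseteq> U"
    using assms(1,2) open_contains_ball by blast
  have "u - (e / 2) *\<^sub>R axis (Max UNIV) 1 \<in> ball u e"
    using e by (simp add: dist_norm)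
  then have "u - (e / 2) *\<^sub>R axis (Max UNIV) 1 \<in> Hp_star"
    using e(2) assms(3) by blast
  then show False
    using neg e(1) by (simp add: Hp_star_def)
qed

section \<open>Normal distributions under linear maps\<close>

text \<open>Uniqueness of Haar measure. The library computes the Lebesgue measure of a linear image only
  for well-ordered index types, and here the constant can be recovered by normalisation.\<close>
lemma translation_invariant_eq_lborel:
  fixes \<mu> :: "'a::euclidean_space measure"
  assumes "sigma_finite_measure \<mu>" and sets[measurable_cong]: "sets \<mu> = sets borel"
    and inv: "\<And>c. distr \<mu> borel ((+) c) = \<mu>"
  shows "\<exists>k. \<mu> = density lborel (\<lambda>_. k)"
proof -
  interpret mu: sigma_finite_measure \<mu> by fact
  interpret P: pair_sigma_finite \<mu> "lborel :: 'a measure" ..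
  \<comment> \<open>The unit ball serves for normalisation: its Lebesgue measure is positive and
    finite, and it is symmetric about 0.\<close>
  define B :: "'a set" where "B = ball 0 1"
  have [measurable]: "B \<in> sets borel" by (simp add: B_def)
  have B_minus: "indicator B (- x) = (indicator B x :: ennreal)" for x
    by (simp add: B_def indicator_def)
  have shift: "(\<integral>\<^sup>+ y. indicator S (c + y) \<partial>lborel) = emeasure lborel S"
    if [measurable]: "S \<in> sets borel" for S and c :: 'a
  proof -
    have "(\<integral>\<^sup>+ y. indicator S (c + y) \<partial>lborel) = (\<integral>\<^sup>+ y. indicator S y \<partial>distr lborel borel ((+) c))"
      by (subst nn_integral_distr) auto
    then show ?thesis by (simp add: lborel_distr_plus)
  qed
  have eq: "emeasure \<mu> A * emeasure lborel B = emeasure \<mu> B * emeasure lborel A"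
    if [measurable]: "A \<in> sets borel" for A
  proof -
    have A': "A \<in> sets \<mu>" "B \<in> sets \<mu>" by (simp_all add: sets)
    have "emeasure \<mu> A * emeasure lborel B = (\<integral>\<^sup>+ x. indicator A x * emeasure lborel B \<partial>\<mu>)"
      using A' by (subst nn_integral_multc) auto
    \<comment> \<open>The double integral of 1_A(x) 1_B(y - x) is evaluated in both orders.
      Invariance of the first measure replaces x by y + x, symmetry of the ball turns 1_B(-x) into
      1_B(x), and invariance of Lebesgue measure removes the shift of \<open>A\<close>.\<close>
    also have "\<dots> = (\<integral>\<^sup>+ x. (\<integral>\<^sup>+ y. indicator A x * indicator B (- x + y) \<partial>lborel) \<partial>\<mu>)"
      by (intro nn_integral_cong, subst nn_integral_cmult)
        (measurable, simp only: shift[OF \<open>B \<in> sets borel\<close>])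
    also have "\<dots> = (\<integral>\<^sup>+ y. (\<integral>\<^sup>+ x. indicator A x * indicator B (- x + y) \<partial>\<mu>) \<partial>lborel)"
      by (rule P.Fubini'[symmetric]) measurable
    also have "\<dots> = (\<integral>\<^sup>+ y. (\<integral>\<^sup>+ x. indicator A (y + x) * indicator B x \<partial>\<mu>) \<partial>lborel)"
    proof (rule nn_integral_cong)
      fix y :: 'a
      have "(\<integral>\<^sup>+ x. indicator A x * indicator B (- x + y) \<partial>\<mu>)
          = (\<integral>\<^sup>+ x. indicator A x * indicator B (- x + y) \<partial>distr \<mu> borel ((+) y))"
        by (simp only: inv)
      also have "\<dots> = (\<integral>\<^sup>+ x. indicator A (y + x) * indicator B (- (y + x) + y) \<partial>\<mu>)"
        by (rule nn_integral_distr) measurable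
      also have "\<dots> = (\<integral>\<^sup>+ x. indicator A (y + x) * indicator B x \<partial>\<mu>)"
        by (simp add: B_minus)
      finally show "(\<integral>\<^sup>+ x. indicator A x * indicator B (- x + y) \<partial>\<mu>)
          = (\<integral>\<^sup>+ x. indicator A (y + x) * indicator B x \<partial>\<mu>)" .
    qed
    also have "\<dots> = (\<integral>\<^sup>+ x. (\<integral>\<^sup>+ y. indicator A (y + x) * indicator B x \<partial>lborel) \<partial>\<mu>)"
      by (rule P.Fubini') measurable
    also have "\<dots> = (\<integral>\<^sup>+ x. emeasure lborel A * indicator B x \<partial>\<mu>)"
    proof (intro nn_integral_cong, subst nn_integral_multc)
      fix x :: 'a
      show "(\<integral>\<^sup>+ y. indicator A (y + x) \<partial>lborel) * indicator B x = emeasure lborel A * indicator B x"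
        using shift[OF that, of x] by (simp add: add.commute)
    qed auto
    also have "\<dots> = emeasure \<mu> B * emeasure lborel A"
      using A' by (subst nn_integral_cmult) (auto simp: mult.commute)
    finally show ?thesis .
  qed
  let ?b = "emeasure lborel B"
  have b: "?b \<noteq> 0" "?b \<noteq> \<infinity>"
  proof -
    show "?b \<noteq> \<infinity>"
      using emeasure_lborel_ball_finite[of "0::'a" 1] by (simp add: B_def)
    have "0 < measure lborel B"
      unfolding B_def by (simp add: content_ball_pos)
    then show "?b \<noteq> 0" by (auto simp: measure_def)
  qed
  have "\<mu> = density lborel (\<lambda>_. emeasure \<mu> B / ?b)"
  proof (rule measure_eqI)
    fix A assume "A \<in> sets \<mu>"
    then have A: "A \<in> sets borel" by (simp add: sets)
    have "emeasure \<mu> A = emeasure \<mu> A * ?b / ?b"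
      using b by (simp add: ennreal_mult_divide_eq)
    also have "\<dots> = emeasure \<mu> B * emeasure lborel A / ?b"
      by (simp only: eq[OF A])
    also have "\<dots> = emeasure \<mu> B / ?b * emeasure lborel A"
      by (simp add: divide_ennreal_def mult_ac)
    finally show "emeasure \<mu> A = emeasure (density lborel (\<lambda>_. emeasure \<mu> B / ?b)) A"
      using A by (simp add: emeasure_density_const)
  qed (simp add: sets)
  then show ?thesis by blast
qed

lemma borel_measurable_matrix_vector_mult [measurable]:
  fixes A :: "real^'p^'p"
  shows "(*v) A \<in> borel_measurable borel"
  by (intro borel_measurable_continuous_onI linear_continuous_on
      matrix_vector_mul_bounded_linear)

text \<open>Translating the image by \<open>c\<close> amounts to translating the source by
  \<open>matrix_inv A *v c\<close>, which leaves Lebesgue measure fixed. The image measure is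
  sigma-finite because the inverse map carries it back to Lebesgue measure.\<close>

lemma distr_lborel_linear:
  fixes A :: "real^'p^'p"
  assumes "invertible A"
  shows "\<exists>k. distr lborel borel ((*v) A) = density lborel (\<lambda>_. k)"
proof (rule translation_invariant_eq_lborel)
  let ?\<mu> = "distr lborel borel ((*v) A)"
  have "distr ?\<mu> borel ((*v) (matrix_inv A)) = distr lborel borel (\<lambda>x. x)"
    using assms by (subst distr_distr) (auto simp: o_def intro!: distr_cong)
  then have "distr ?\<mu> borel ((*v) (matrix_inv A)) = lborel"
    by (simp add: distr_id2)
  then show "sigma_finite_measure ?\<mu>"
    using sigma_finite_measure_distr[of ?\<mu> borel "(*v) (matrix_inv A)"]
    by (simp add: sigma_finite_lborel)
  show "sets ?\<mu> = sets borel" by simp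
  show "distr ?\<mu> borel ((+) c) = ?\<mu>" for c
  proof -
    have "distr ?\<mu> borel ((+) c) = distr lborel borel (\<lambda>x. A *v (matrix_inv A *v c + x))"
      using assms by (subst distr_distr) (auto simp: o_def matrix_vector_right_distrib)
    also have "\<dots> = distr (distr lborel borel ((+) (matrix_inv A *v c))) borel ((*v) A)"
      by (subst distr_distr) (auto simp: o_def)
    finally show ?thesis by (simp add: lborel_distr_plus)
  qed
qed

lemma det_pos_spd:
  fixes S :: "real^'p^'p"
  assumes "S \<in> spd_matrices"
  shows "0 < det S"
proof -
  obtain B :: "real^'p^'p" where B: "invertible B" "B ** transpose B = S"
    using spd_factorization[OF assms] by blast
  then have "det S = (det B)\<^sup>2"
    by (auto simp: det_mul power2_eq_square)
  then show ?thesis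
    using B(1) by (simp add: invertible_det_nz)
qed

lemma mvn_density_pos: "\<Sigma> \<in> spd_matrices \<Longrightarrow> 0 < mvn_density \<theta> \<Sigma> x"
  by (simp add: mvn_density_def det_pos_spd)

lemma borel_measurable_mvn_density [measurable]: "mvn_density \<theta> \<Sigma> \<in> borel_measurable borel"
  unfolding mvn_density_def divide_inverse
  by (intro borel_measurable_continuous_onI continuous_intros
      linear_continuous_on_compose[OF _ matrix_vector_mul_linear])

definition mvn :: "real^'p \<Rightarrow> real^'p^'p \<Rightarrow> (real^'p) measure" where
  "mvn \<theta> \<Sigma> = density lborel (\<lambda>x. ennreal (mvn_density \<theta> \<Sigma> x))"

lemma sets_mvn [measurable_cong, simp]: "sets (mvn \<theta> \<Sigma>) = sets borel"
  by (simp add: mvn_def)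

lemma space_mvn [simp]: "space (mvn \<theta> \<Sigma>) = UNIV"
  by (simp add: mvn_def)

text \<open>The exponents agree after the substitution, so the two measures differ by a constant
  factor, which is 1 because both have total mass 1. The \<open>prob_space\<close> assumptions
  thereby replace evaluating the Gaussian integral and the Jacobian.\<close>

lemma distr_mvn_linear:
  fixes A :: "real^'p^'p"
  assumes A: "invertible A"
    and "prob_space (mvn 0 (mat 1 :: real^'p^'p))" "prob_space (mvn 0 (A ** transpose A))"
  shows "distr (mvn 0 (mat 1)) borel ((*v) A) = mvn 0 (A ** transpose A)"
proof -
  let ?I = "mat 1 :: real^'p^'p" and ?S = "A ** transpose A"
  interpret I: prob_space "mvn 0 ?I" by fact
  interpret S: prob_space "mvn 0 ?S" by fact
  interpret D: prob_space "distr (mvn 0 ?I) borel ((*v) A)"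
    by (rule I.prob_space_distr) measurable
  obtain k where k: "distr lborel borel ((*v) A) = density lborel (\<lambda>_. k)"
    using distr_lborel_linear[OF A] by blast
  \<comment> \<open>The ratio of the normalising constants, read off at 0, where both exponentials
    are 1.\<close>
  define q where "q = mvn_density 0 ?I 0 / mvn_density 0 ?S 0"
  have pos: "0 < mvn_density 0 ?I 0" "0 < mvn_density 0 ?S 0"
    using mvn_density_pos factor_spd[OF A] mat_1_spd by blast+
  then have q: "0 < q" by (simp add: q_def)
  have f: "mvn_density 0 ?I x = q * mvn_density 0 ?S (A *v x)" for x
  proof -
    have form: "(A *v x) \<bullet> (matrix_inv ?S *v (A *v x)) = x \<bullet> x"
      using inner_wrt_factor[OF A, of "A *v x" "A *v x"] A by (simp add: inner_wrt_def)
    have inv1: "matrix_inv ?I = ?I" by (rule matrix_inv_unique) simp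
    have "mvn_density 0 ?I x = mvn_density 0 ?I 0 * exp (- (x \<bullet> x) / 2)"
      by (simp add: mvn_density_def inv1)
    moreover have "mvn_density 0 ?S (A *v x) = mvn_density 0 ?S 0 * exp (- (x \<bullet> x) / 2)"
      using form by (simp add: mvn_density_def)
    ultimately show ?thesis
      using pos by (simp add: q_def)
  qed
  let ?r = "k * ennreal q"
  have scale: "emeasure (distr (mvn 0 ?I) borel ((*v) A)) B = ?r * emeasure (mvn 0 ?S) B"
    if [measurable]: "B \<in> sets borel" for B
  proof -
    let ?h = "\<lambda>y. ennreal q * (ennreal (mvn_density 0 ?S y) * indicator B y)"
    have "emeasure (distr (mvn 0 ?I) borel ((*v) A)) B
        = (\<integral>\<^sup>+ x. indicator B x \<partial>distr (mvn 0 ?I) borel ((*v) A))"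
      by simp
    also have "\<dots> = (\<integral>\<^sup>+ x. indicator B (A *v x) \<partial>mvn 0 ?I)"
      by (rule nn_integral_distr) measurable
    also have "\<dots> = (\<integral>\<^sup>+ x. ennreal (mvn_density 0 ?I x) * indicator B (A *v x) \<partial>lborel)"
      unfolding mvn_def by (rule nn_integral_density) measurable
    also have "\<dots> = (\<integral>\<^sup>+ x. ?h (A *v x) \<partial>lborel)"
      using q by (intro nn_integral_cong) (simp add: f ennreal_mult' mult_ac)
    also have "\<dots> = (\<integral>\<^sup>+ y. ?h y \<partial>distr lborel borel ((*v) A))"
      by (rule nn_integral_distr[symmetric]) measurable
    also have "\<dots> = (\<integral>\<^sup>+ y. k * ?h y \<partial>lborel)"
      unfolding k by (rule nn_integral_density) measurable
    also have "\<dots> = ?r * (\<integral>\<^sup>+ y. ennreal (mvn_density 0 ?S y) * indicator B y \<partial>lborel)"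
      by (subst nn_integral_cmult[symmetric]) (auto simp: mult_ac)
    also have "\<dots> = ?r * emeasure (mvn 0 ?S) B"
      by (simp add: mvn_def emeasure_density)
    finally show ?thesis .
  qed
  have "?r = 1"
    using scale[of UNIV] D.emeasure_space_1 S.emeasure_space_1 by simp
  then show ?thesis
    using scale by (intro measure_eqI) auto
qed

section \<open>Laws of independent normal samples\<close>

lemma iid_mvn_prob_space: "iid_mvn M n X \<theta> \<Sigma> \<Longrightarrow> prob_space M"
  by (simp add: iid_mvn_def)

lemma
  assumes "iid_mvn M n X \<theta> \<Sigma>" "i \<in> {1..n}"
  shows iid_mvn_measurable: "X i \<in> borel_measurable M"
    and iid_mvn_distr: "distr M borel (X i) = mvn \<theta> \<Sigma>"
proof -
  have D: "distributed M lborel (X i) (\<lambda>x. ennreal (mvn_density \<theta> \<Sigma> x))"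
    using assms by (simp add: iid_mvn_def)
  show "X i \<in> borel_measurable M"
    using distributed_measurable[OF D] by simp
  have "distr M borel (X i) = distr M lborel (X i)"
    by (intro distr_cong) simp_all
  then show "distr M borel (X i) = mvn \<theta> \<Sigma>"
    using distributed_distr_eq_density[OF D] by (simp add: mvn_def)
qed

text \<open>The density has total mass 1 because it is the density of the random variable
  \<open>X 1\<close> of the model.\<close>

lemma iid_mvn_prob_space_mvn:
  assumes "iid_mvn M n X \<theta> \<Sigma>" "0 < n"
  shows "prob_space (mvn \<theta> \<Sigma>)"
proof -
  have 1: "(1::nat) \<in> {1..n}" using assms(2) by simp
  show ?thesis
    using prob_space.prob_space_distr[OF iid_mvn_prob_space[OF assms(1)] iid_mvn_measurable[OF assms(1) 1]]
    unfolding iid_mvn_distr[OF assms(1) 1] .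
qed

lemma iid_mvn_linear:
  fixes A :: "real^'p^'p"
  assumes X: "iid_mvn M n X 0 (mat 1)" and A: "invertible A"
    and P: "prob_space (mvn 0 (A ** transpose A))"
  shows "iid_mvn M n (\<lambda>i \<omega>. A *v X i \<omega>) 0 (A ** transpose A)"
  unfolding iid_mvn_def
proof (intro conjI ballI)
  show M: "prob_space M" using X by (rule iid_mvn_prob_space)
  have "prob_space.indep_vars M (\<lambda>_. borel) X {1..n}"
    using X by (simp add: iid_mvn_def)
  then show "prob_space.indep_vars M (\<lambda>_. borel) (\<lambda>i \<omega>. A *v X i \<omega>) {1..n}"
    by (rule prob_space.indep_vars_compose2[OF M]) measurable
  fix i assume i: "i \<in> {1..n}"
  then have n: "0 < n" by simp
  have [measurable]: "X i \<in> borel_measurable M"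
    using X i by (rule iid_mvn_measurable)
  have "distr M lborel (\<lambda>\<omega>. A *v X i \<omega>) = distr M borel (\<lambda>\<omega>. A *v X i \<omega>)"
    by (intro distr_cong) simp_all
  also have "\<dots> = distr (distr M borel (X i)) borel ((*v) A)"
    by (subst distr_distr) (auto simp: o_def)
  also have "\<dots> = mvn 0 (A ** transpose A)"
    unfolding iid_mvn_distr[OF X i]
    by (rule distr_mvn_linear[OF A iid_mvn_prob_space_mvn[OF X n] P])
  finally show "distributed M lborel (\<lambda>\<omega>. A *v X i \<omega>) (\<lambda>x. ennreal (mvn_density 0 (A ** transpose A) x))"
    by (simp add: distributed_def mvn_def)
qed

lemma iid_mvn_law:
  assumes "iid_mvn M n X \<theta> \<Sigma>" "0 < n"
  shows "distr M (\<Pi>\<^sub>M i\<in>{1..n}. borel) (\<lambda>\<omega>. \<lambda>i\<in>{1..n}. X i \<omega>) = (\<Pi>\<^sub>M i\<in>{1..n}. mvn \<theta> \<Sigma>)"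
proof -
  interpret prob_space M using assms(1) by (rule iid_mvn_prob_space)
  have "indep_vars (\<lambda>_. borel) X {1..n}"
    using assms(1) by (simp add: iid_mvn_def)
  then have "distr M (\<Pi>\<^sub>M i\<in>{1..n}. borel) (\<lambda>\<omega>. \<lambda>i\<in>{1..n}. X i \<omega>)
      = (\<Pi>\<^sub>M i\<in>{1..n}. distr M borel (X i))"
    using assms iid_mvn_measurable[OF assms(1)]
    by (subst indep_vars_iff_distr_eq_PiM'[symmetric]) auto
  also have "\<dots> = (\<Pi>\<^sub>M i\<in>{1..n}. mvn \<theta> \<Sigma>)"
    by (intro PiM_cong refl iid_mvn_distr[OF assms(1)])
  finally show ?thesis .
qed

text \<open>A nonempty open set contains a ball of positive Lebesgue measure and the normal density
  is strictly positive; independence turns the intersection into a product of positive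
  factors.\<close>

lemma iid_mvn_open_pos:
  assumes X: "iid_mvn M n X \<theta> \<Sigma>" and S: "\<Sigma> \<in> spd_matrices" and n: "0 < n"
    and U: "\<And>i. i \<in> {1..n} \<Longrightarrow> open (U i) \<and> U i \<noteq> {}"
  shows "0 < measure M (\<Inter>i\<in>{1..n}. X i -` U i \<inter> space M)"
proof -
  interpret prob_space M using X by (rule iid_mvn_prob_space)
  have pos: "0 < prob (X i -` U i \<inter> space M)" if i: "i \<in> {1..n}" for i
  proof -
    have [measurable]: "U i \<in> sets borel" using U[OF i] by simp
    have "emeasure M (X i -` U i \<inter> space M) = emeasure (mvn \<theta> \<Sigma>) (U i)"
      using iid_mvn_measurable[OF X i] iid_mvn_distr[OF X i]
      by (metis \<open>U i \<in> sets borel\<close> emeasure_distr)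
    moreover have "emeasure (mvn \<theta> \<Sigma>) (U i) \<noteq> 0"
    proof
      assume "emeasure (mvn \<theta> \<Sigma>) (U i) = 0"
      then have "AE x in lborel. ennreal (mvn_density \<theta> \<Sigma> x) * indicator (U i) x = 0"
        by (simp add: mvn_def emeasure_density nn_integral_0_iff_AE)
      then have "AE x in lborel. x \<notin> U i"
      proof (rule eventually_mono)
        fix x assume "ennreal (mvn_density \<theta> \<Sigma> x) * indicator (U i) x = 0"
        then show "x \<notin> U i"
          using mvn_density_pos[OF S, of \<theta> x] by (auto simp: indicator_def ennreal_eq_0_iff)
      qed
      moreover from U[OF i] obtain a r where r: "0 < r" "ball a r \<subseteq> U i"
        by (metis all_not_in_conv open_contains_ball)
      ultimately have "AE x in lborel. x \<notin> ball a r"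
        by (auto elim!: eventually_mono)
      then have "emeasure lborel (ball a r) = 0"
        by (subst (asm) AE_iff_measurable[of "ball a r"]) auto
      then have "measure lborel (ball a r) = 0" by (simp add: measure_def)
      then show False using content_ball_pos[OF r(1), of a] by simp
    qed
    ultimately show ?thesis
      by (metis emeasure_eq_measure ennreal_0 zero_less_measure_iff)
  qed
  have "prob (\<Inter>i\<in>{1..n}. X i -` U i \<inter> space M) = (\<Prod>i\<in>{1..n}. prob (X i -` U i \<inter> space M))"
    using X U n by (intro indep_varsD_finite[where M' = "\<lambda>_. borel"]) (auto simp: iid_mvn_def)
  also have "\<dots> > 0"
    using pos by (intro prod_pos) auto
  finally show ?thesis .
qed

section \<open>Measurability and continuity of the statistic\<close>

text \<open>\<open>y \<bullet> (matrix_inv S *v y)\<close> by Cramer's rule: a rational function of the entries, hence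
  measurable and continuous off the zero set of the determinant.\<close>
definition cramer_form :: "real^'p^'p \<Rightarrow> real^'p \<Rightarrow> real" where
  "cramer_form S y = (\<Sum>k\<in>UNIV. y $ k * det (\<chi> i j. if j = k then y $ i else S $ i $ j)) / det S"

lemma inner_wrt_cramer:
  fixes S :: "real^'p^'p"
  assumes "det S \<noteq> 0"
  shows "inner_wrt S y y = cramer_form S y"
proof -
  have "S *v (matrix_inv S *v y) = y"
    using assms by (simp add: invertible_det_nz)
  then have "matrix_inv S *v y = (\<chi> k. det (\<chi> i j. if j = k then y $ i else S $ i $ j) / det S)"
    using cramer[OF assms] by blast
  then show ?thesis
    by (simp add: inner_wrt_def cramer_form_def inner_vec_def sum_divide_distrib)
qed

lemma norm_wrt_power2:
  fixes S :: "real^'p^'p"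
  assumes "S \<in> spd_matrices"
  shows "(norm_wrt S y)\<^sup>2 = inner_wrt S y y"
proof -
  obtain B :: "real^'p^'p" where B: "invertible B" "B ** transpose B = S"
    using spd_factorization[OF assms] by blast
  show ?thesis
    using inner_wrt_factor[OF B(1), of y y] B(2) by (simp add: norm_wrt_def)
qed

lemma fit_scatter_cramer:
  assumes "det (scatter n x) \<noteq> 0"
  shows "fit (scatter n x) y w = (1 + cramer_form (scatter n x) y) / (1 + cramer_form (scatter n x) (y - w)) - 1"
  using assms scatter_spd_iff[of n x]
  by (simp add: fit_def norm_wrt_power2 inner_wrt_cramer)

lemma borel_measurable_vec_nth [measurable]: "(\<lambda>x::real^'p. x $ i) \<in> borel_measurable borel"
  by (intro borel_measurable_continuous_onI continuous_intros)

lemma borel_measurable_det: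
  fixes A :: "'a \<Rightarrow> real^'p^'p"
  assumes "\<And>i j. (\<lambda>\<omega>. A \<omega> $ i $ j) \<in> borel_measurable M"
  shows "(\<lambda>\<omega>. det (A \<omega>)) \<in> borel_measurable M"
  unfolding det_def
  by (intro borel_measurable_sum borel_measurable_times borel_measurable_const borel_measurable_prod assms)

lemma borel_measurable_cramer_form:
  fixes A :: "'a \<Rightarrow> real^'p^'p"
  assumes A: "\<And>i j. (\<lambda>\<omega>. A \<omega> $ i $ j) \<in> borel_measurable M"
    and y[measurable]: "y \<in> borel_measurable M"
  shows "(\<lambda>\<omega>. cramer_form (A \<omega>) (y \<omega>)) \<in> borel_measurable M"
proof -
  have "(\<lambda>\<omega>. det (\<chi> i j. if j = k then y \<omega> $ i else A \<omega> $ i $ j)) \<in> borel_measurable M" for k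
  proof (rule borel_measurable_det)
    show "(\<lambda>\<omega>. (\<chi> i j. if j = k then y \<omega> $ i else A \<omega> $ i $ j) $ i $ j) \<in> borel_measurable M" for i j
      using A by (cases "j = k") simp_all
  qed
  moreover have "(\<lambda>\<omega>. y \<omega> $ k) \<in> borel_measurable M" for k
    by measurable
  moreover have "(\<lambda>\<omega>. det (A \<omega>)) \<in> borel_measurable M"
    using A by (rule borel_measurable_det)
  ultimately show ?thesis
    unfolding cramer_form_def
    by (intro borel_measurable_divide borel_measurable_sum borel_measurable_times)
qed

lemma borel_measurable_sample_mean:
  assumes "\<And>i. i \<in> {1..n} \<Longrightarrow> X i \<in> borel_measurable M"
  shows "(\<lambda>\<omega>. sample_mean n (\<lambda>i. X i \<omega>)) \<in> borel_measurable M"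
  unfolding sample_mean_def
  by (intro borel_measurable_scaleR borel_measurable_const borel_measurable_sum assms)

lemma borel_measurable_scatter:
  assumes "\<And>i. i \<in> {1..n} \<Longrightarrow> X i \<in> borel_measurable M"
  shows "(\<lambda>\<omega>. scatter n (\<lambda>i. X i \<omega>) $ a $ b) \<in> borel_measurable M"
proof -
  have "(\<lambda>\<omega>. (X i \<omega> - sample_mean n (\<lambda>i. X i \<omega>)) $ a) \<in> borel_measurable M" if "i \<in> {1..n}" for i a
    using assms[OF that] borel_measurable_sample_mean[OF assms] by measurable
  then show ?thesis
    unfolding scatter_def outer_prod_def sum_component vec_lambda_beta
    by (intro borel_measurable_sum borel_measurable_times)
qed

lemma LRT_nonneg: "0 \<le> LRT n C x"
  by (simp add: LRT_def Let_def)

text \<open>Prepares measurability, with \<open>D\<close> a countable dense subset of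
  \<open>C\<close>. By continuity of \<open>fit\<close> the maximum over \<open>C\<close> is the
  supremum over \<open>D\<close>; it need not be attained on \<open>D\<close>, hence the slack
  \<open>1 / real (Suc j)\<close>.\<close>

lemma LRT_ge_iff_countable:
  assumes C: "closed_convex_cone C" and D: "D \<subseteq> C" "C \<subseteq> closure D" and a: "0 < a"
  shows "a \<le> LRT n C x \<longleftrightarrow> det (scatter n x) \<noteq> 0 \<and>
    (\<forall>j::nat. \<exists>w\<in>D. a - 1 / real (Suc j) < fit (scatter n x) (root_mean n x) w)"
    (is "_ \<longleftrightarrow> _ \<and> (\<forall>j. \<exists>w\<in>D. _ < ?f w)")
proof (intro iffI conjI allI)
  assume *: "a \<le> LRT n C x"
  then obtain w where w: "w \<in> C" "a \<le> ?f w" and spd: "scatter n x \<in> spd_matrices"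
    using LRT_ge_iff[OF C a] by blast
  show "det (scatter n x) \<noteq> 0"
    using spd scatter_spd_iff by blast
  fix j
  let ?O = "{w. a - 1 / real (Suc j) < ?f w}"
  have "open ?O"
    by (intro open_Collect_less continuous_on_const continuous_on_fit)
  moreover have "a - 1 / real (Suc j) < a" by simp
  from less_le_trans[OF this w(2)] have "w \<in> ?O" by simp
  ultimately have "?O \<inter> D \<noteq> {}"
    using w(1) D(2) open_Int_closure_eq_empty[of ?O D] by blast
  then show "\<exists>w\<in>D. a - 1 / real (Suc j) < ?f w" by blast
next
  assume *: "det (scatter n x) \<noteq> 0 \<and> (\<forall>j::nat. \<exists>w\<in>D. a - 1 / real (Suc j) < ?f w)"
  then have spd: "scatter n x \<in> spd_matrices"
    using scatter_spd_iff by blast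
  show "a \<le> LRT n C x"
  proof (rule ccontr)
    assume "\<not> a \<le> LRT n C x"
    then obtain j where "1 / real (Suc j) < a - LRT n C x"
      using nat_approx_posE[of "a - LRT n C x"] by auto
    moreover obtain w where "w \<in> D" "a - 1 / real (Suc j) < ?f w"
      using * by blast
    ultimately show False
      using LRT_max_fit(2)[OF spd C, of w] D(1) by force
  qed
qed

lemma borel_measurable_LRT:
  assumes X: "\<And>i. i \<in> {1..n} \<Longrightarrow> X i \<in> borel_measurable M" and C: "closed_convex_cone C"
  shows "(\<lambda>\<omega>. LRT n C (\<lambda>i. X i \<omega>)) \<in> borel_measurable M"
  unfolding borel_measurable_iff_ge
proof
  fix a
  let ?S = "\<lambda>\<omega>. scatter n (\<lambda>i. X i \<omega>)" and ?y = "\<lambda>\<omega>. root_mean n (\<lambda>i. X i \<omega>)"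
  show "{\<omega> \<in> space M. a \<le> LRT n C (\<lambda>i. X i \<omega>)} \<in> sets M"
  proof (cases "0 < a")
    case False
    then have "{\<omega> \<in> space M. a \<le> LRT n C (\<lambda>i. X i \<omega>)} = space M"
      using LRT_nonneg order_trans by (force simp: not_less)
    then show ?thesis by simp
  next
    case True
    obtain D where D: "countable D" "D \<subseteq> C" "C \<subseteq> closure D"
      by (rule separable)
    define F where
      "F w \<omega> = (1 + cramer_form (?S \<omega>) (?y \<omega>)) / (1 + cramer_form (?S \<omega>) (?y \<omega> - w)) - 1" for w \<omega>
    have S: "(\<lambda>\<omega>. ?S \<omega> $ i $ j) \<in> borel_measurable M" for i j
      using X by (rule borel_measurable_scatter)
    have y[measurable]: "?y \<in> borel_measurable M"
      unfolding root_mean_def using borel_measurable_sample_mean[OF X] by simp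
    have [measurable]: "F w \<in> borel_measurable M" for w
      unfolding F_def
      by (intro borel_measurable_diff borel_measurable_divide borel_measurable_add
          borel_measurable_const borel_measurable_cramer_form S y)
    have [measurable]: "(\<lambda>\<omega>. det (?S \<omega>)) \<in> borel_measurable M"
      using S by (rule borel_measurable_det)
    have "a \<le> LRT n C (\<lambda>i. X i \<omega>) \<longleftrightarrow>
        det (?S \<omega>) \<noteq> 0 \<and> (\<forall>j::nat. \<exists>w\<in>D. a - 1 / real (Suc j) < F w \<omega>)" for \<omega>
      unfolding LRT_ge_iff_countable[OF C D(2,3) True] F_def
      by (auto simp: fit_scatter_cramer)
    then have "{\<omega> \<in> space M. a \<le> LRT n C (\<lambda>i. X i \<omega>)} = {\<omega> \<in> space M. det (?S \<omega>) \<noteq> 0} \<inter>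
        (\<Inter>j::nat. \<Union>w\<in>D. {\<omega> \<in> space M. a - 1 / real (Suc j) < F w \<omega>})"
      by auto
    also have "\<dots> \<in> sets M"
    proof (rule sets.Int)
      show "{\<omega> \<in> space M. det (?S \<omega>) \<noteq> 0} \<in> sets M" by measurable
      have "{\<omega> \<in> space M. a - 1 / real (Suc j) < F w \<omega>} \<in> sets M" for j w
        by measurable
      then have "(\<Union>w\<in>D. {\<omega> \<in> space M. a - 1 / real (Suc j) < F w \<omega>}) \<in> sets M" for j
        using D(1) by (intro sets.countable_UN') auto
      then show "(\<Inter>j::nat. \<Union>w\<in>D. {\<omega> \<in> space M. a - 1 / real (Suc j) < F w \<omega>}) \<in> sets M"
        by (intro sets.countable_INT) auto
    qed
    finally show ?thesis .
  qed
qed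

text \<open>The right-hand side depends on the sample only through its parameters, so samples with
  equal parameters, even on different probability spaces, have equal rejection
  probabilities.\<close>

lemma iid_mvn_LRT_prob:
  fixes C :: "(real^'p) set"
  assumes X: "iid_mvn M n X \<theta> \<Sigma>" and n: "0 < n" and C: "closed_convex_cone C"
  shows "measure M {\<omega> \<in> space M. d \<le> LRT n C (\<lambda>i. X i \<omega>)} =
    measure (\<Pi>\<^sub>M i\<in>{1..n}. mvn \<theta> \<Sigma>) {x \<in> space (\<Pi>\<^sub>M i\<in>{1..n}. borel). d \<le> LRT n C x}"
proof -
  let ?T = "\<lambda>\<omega>. \<lambda>i\<in>{1..n}. X i \<omega>" and ?N = "\<Pi>\<^sub>M i\<in>{1..n}. borel :: (real^'p) measure"
  have T: "?T \<in> M \<rightarrow>\<^sub>M ?N"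
    using iid_mvn_measurable[OF X] by (intro measurable_restrict)
  have "(\<lambda>x. LRT n C (\<lambda>i. x i)) \<in> borel_measurable ?N"
    by (rule borel_measurable_LRT[OF _ C]) simp
  then have E: "{x \<in> space ?N. d \<le> LRT n C x} \<in> sets ?N"
    by simp
  have "?T -` {x \<in> space ?N. d \<le> LRT n C x} \<inter> space M = {\<omega> \<in> space M. d \<le> LRT n C (\<lambda>i. X i \<omega>)}"
    using measurable_space[OF T] LRT_cong[of n "?T \<omega>" "\<lambda>i. X i \<omega>" C for \<omega>] by auto
  then show ?thesis
    using measure_distr[OF T E] iid_mvn_law[OF X n] by simp
qed

lemma continuous_on_det:
  fixes A :: "'a::topological_space \<Rightarrow> real^'p^'p"
  assumes "\<And>i j. continuous_on T (\<lambda>x. A x $ i $ j)"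
  shows "continuous_on T (\<lambda>x. det (A x))"
  unfolding det_def by (intro continuous_intros assms)

text \<open>For \<open>m = Max UNIV\<close> the form equals the half-space statistic on this set, so
  the set consists of samples whose statistic lies strictly between \<open>a\<close> and
  \<open>b\<close>.\<close>

lemma open_scatter_region:
  fixes a b :: real and m :: "'p::finite"
  shows "open {x :: nat \<Rightarrow> real^'p. det (scatter n x) \<noteq> 0 \<and> 0 < root_mean n x $ m \<and>
    a < cramer_form (scatter n x) (root_mean n x) \<and> cramer_form (scatter n x) (root_mean n x) < b}"
proof -
  have coord: "continuous_on UNIV (\<lambda>x :: nat \<Rightarrow> real^'p. x i)" for i
    by (rule continuous_on_product_coordinates)
  have mean: "continuous_on UNIV (\<lambda>x :: nat \<Rightarrow> real^'p. sample_mean n x)"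
    unfolding sample_mean_def by (intro continuous_intros coord)
  then have root: "continuous_on UNIV (\<lambda>x :: nat \<Rightarrow> real^'p. root_mean n x)"
    unfolding root_mean_def by (intro continuous_intros)
  have S: "continuous_on UNIV (\<lambda>x :: nat \<Rightarrow> real^'p. scatter n x $ i $ j)" for i j
    unfolding scatter_def outer_prod_def sum_component vec_lambda_beta
    by (intro continuous_intros coord mean)
  have det: "continuous_on UNIV (\<lambda>x :: nat \<Rightarrow> real^'p. det (scatter n x))"
    by (rule continuous_on_det[OF S])
  let ?V = "{x :: nat \<Rightarrow> real^'p. det (scatter n x) \<noteq> 0}"
  have V: "open ?V"
    by (intro open_Collect_neq det continuous_on_const)
  have num: "continuous_on UNIV (\<lambda>x :: nat \<Rightarrow> real^'p.
      det (\<chi> i j. if j = k then root_mean n x $ i else scatter n x $ i $ j))" for k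
  proof (rule continuous_on_det)
    show "continuous_on UNIV (\<lambda>x :: nat \<Rightarrow> real^'p.
        (\<chi> i j. if j = k then root_mean n x $ i else scatter n x $ i $ j) $ i $ j)" for i j
      using S continuous_on_component[OF root] by (cases "j = k") simp_all
  qed
  have "continuous_on ?V (\<lambda>x. cramer_form (scatter n x) (root_mean n x))"
    unfolding cramer_form_def
    by (intro continuous_intros ballI continuous_on_subset[OF num] continuous_on_subset[OF det]
        continuous_on_subset[OF root]) auto
  then have "open (?V \<inter> (\<lambda>x. cramer_form (scatter n x) (root_mean n x)) -` {a<..<b})"
    using V by (simp add: continuous_on_open_vimage Int_commute)
  moreover have "open {x :: nat \<Rightarrow> real^'p. 0 < root_mean n x $ m}"
    by (intro open_Collect_less continuous_intros continuous_on_component root)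
  ultimately have "open (?V \<inter> (\<lambda>x. cramer_form (scatter n x) (root_mean n x)) -` {a<..<b} \<inter>
      {x. 0 < root_mean n x $ m})"
    by (rule open_Int)
  then show ?thesis
    by (rule back_subst[where P = "open"]) auto
qed

section \<open>Comparison of the critical values\<close>

text \<open>The image under \<open>A\<close> of a standard normal sample has the law of a sample
  with covariance A A', and the linear map can then be moved from the sample to the cone.\<close>

lemma LRT_power_linear:
  fixes A :: "real^'p^'p"
  assumes model: "\<And>\<theta> \<Sigma>. \<Sigma> \<in> spd_matrices \<Longrightarrow> iid_mvn (P \<theta> \<Sigma>) n X \<theta> \<Sigma>"
    and A: "invertible A" and n: "0 < n" and C: "closed_convex_cone C" and d: "0 < d"
  shows "LRT_power P n X C d 0 (A ** transpose A) = LRT_power P n X ((*v) A -` C) d 0 (mat 1)"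
proof -
  let ?S = "A ** transpose A" and ?M = "P 0 (mat 1)"
  have X: "iid_mvn (P 0 ?S) n X 0 ?S"
    by (rule model[OF factor_spd[OF A]])
  have Y: "iid_mvn ?M n (\<lambda>i \<omega>. A *v X i \<omega>) 0 ?S"
    by (rule iid_mvn_linear[OF model[OF mat_1_spd] A iid_mvn_prob_space_mvn[OF X n]])
  have "LRT_power P n X C d 0 ?S = \<P>(\<omega> in ?M. d \<le> LRT n C (\<lambda>i. A *v X i \<omega>))"
    unfolding LRT_power_def iid_mvn_LRT_prob[OF X n C] iid_mvn_LRT_prob[OF Y n C] ..
  then show ?thesis
    by (simp add: LRT_power_def LRT_linear_ge_iff[OF C A d])
qed

text \<open>Where the half-space statistic exceeds \<open>d\<close>, some \<open>w\<close> in the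
  open half-space has \<open>fit\<close> above \<open>d\<close>, and \<open>w\<close> lies in all
  but finitely many of the preimages of \<open>C\<close>. The event is thus covered by increasing
  events of probability at most \<alpha>.\<close>

lemma prob_LRT_Hp_star_le:
  fixes C :: "(real^'p::{finite,linorder}) set"
  assumes M: "prob_space M" and X: "\<And>i. i \<in> {1..n} \<Longrightarrow> X i \<in> borel_measurable M"
    and C: "closed_convex_cone C" and U: "open U" "u \<in> U" "U \<subseteq> C"
    and u: "0 < u $ Max UNIV" and d: "0 < d"
    and bound: "\<And>k. \<P>(\<omega> in M. d \<le>
      LRT n ((*v) (matrix (squeeze u (Max UNIV) (1 / real (Suc k)))) -` C) (\<lambda>i. X i \<omega>)) \<le> \<alpha>"
  shows "\<P>(\<omega> in M. d < LRT n Hp_star (\<lambda>i. X i \<omega>)) \<le> \<alpha>"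
proof -
  interpret prob_space M by fact
  define D where "D k = (*v) (matrix (squeeze u (Max UNIV) (1 / real (Suc k)))) -` C" for k
  have D: "closed_convex_cone (D k)" for k
    unfolding D_def
    by (intro closed_convex_cone_vimage C invertible_squeeze) (use u in auto)
  have [measurable]: "(\<lambda>\<omega>. LRT n (D k) (\<lambda>i. X i \<omega>)) \<in> borel_measurable M" for k
    using X D by (rule borel_measurable_LRT)
  \<comment> \<open>Demanding rejection for every k from \<open>K\<close> on makes the events
    increase with \<open>K\<close> without any comparison between the cones.\<close>
  define F where "F K = {\<omega> \<in> space M. \<forall>k\<in>{K..}. d \<le> LRT n (D k) (\<lambda>i. X i \<omega>)}" for K
  have F: "F K \<in> sets M" for K
    unfolding F_def by measurable
  have "(\<lambda>K. prob (F K)) \<longlonglongrightarrow> prob (\<Union>K. F K)"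
    by (intro finite_Lim_measure_incseq) (use F in \<open>auto simp: incseq_def F_def\<close>)
  moreover have "prob (F K) \<le> \<alpha>" for K
  proof -
    have "prob (F K) \<le> \<P>(\<omega> in M. d \<le> LRT n (D K) (\<lambda>i. X i \<omega>))"
      by (intro finite_measure_mono) (auto simp: F_def)
    then show ?thesis
      using bound[of K] by (simp add: D_def)
  qed
  ultimately have "prob (\<Union>K. F K) \<le> \<alpha>"
    by (intro LIMSEQ_le_const2) auto
  moreover have "{\<omega> \<in> space M. d < LRT n Hp_star (\<lambda>i. X i \<omega>)} \<subseteq> (\<Union>K. F K)"
  proof clarify
    fix \<omega> assume \<omega>: "\<omega> \<in> space M" and less: "d < LRT n Hp_star (\<lambda>i. X i \<omega>)"
    let ?x = "\<lambda>i. X i \<omega>"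
    have spd: "scatter n ?x \<in> spd_matrices"
      using less d by (intro LRT_pos_imp_spd[of n Hp_star]) simp
    obtain w where w: "0 < w $ Max UNIV" "d < fit (scatter n ?x) (root_mean n ?x) w"
      using LRT_Hp_star_greaterD[OF d less] by blast
    have "eventually (\<lambda>k. squeeze u (Max UNIV) (1 / real (Suc k)) w \<in> C) sequentially"
      using C by (intro eventually_squeeze_in_cone[OF U _ u w(1)]) (simp add: closed_convex_cone_def)
    then obtain K where K: "\<And>k. K \<le> k \<Longrightarrow> squeeze u (Max UNIV) (1 / real (Suc k)) w \<in> C"
      by (auto simp: eventually_sequentially)
    have "d \<le> LRT n (D k) ?x" if "K \<le> k" for k
    proof -
      have "w \<in> D k"
        using K[OF that] by (simp add: D_def fun_cong[OF matrix_vector_mul(2)[OF linear_squeeze]])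
      then show ?thesis
        using w(2) spd LRT_ge_iff[OF D d] by (meson less_imp_le)
    qed
    then show "\<omega> \<in> (\<Union>K. F K)"
      using \<omega> by (auto simp: F_def)
  qed
  then have "\<P>(\<omega> in M. d < LRT n Hp_star (\<lambda>i. X i \<omega>)) \<le> prob (\<Union>K. F K)"
    using F by (intro finite_measure_mono) auto
  ultimately show ?thesis by simp
qed

section \<open>Values taken by the half-space statistic\<close>

lemma LRT_Hp_star_self:
  fixes x :: "nat \<Rightarrow> real^'p::{finite,linorder}"
  assumes spd: "scatter n x \<in> spd_matrices" and pos: "0 \<le> root_mean n x $ Max UNIV"
  shows "LRT n Hp_star x = inner_wrt (scatter n x) (root_mean n x) (root_mean n x)"
proof -
  let ?S = "scatter n x" and ?y = "root_mean n x"
  \<comment> \<open>\<open>fit\<close> is largest where the residual vanishes, and here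
    \<open>?y\<close> itself belongs to the half-space.\<close>
  have le: "fit ?S ?y z \<le> fit ?S ?y ?y" for z
    using norm_wrt_nonneg[OF spd, of "?y - z"]
    by (intro fit_antimono) (simp_all add: norm_wrt_def inner_wrt_def)
  have "?y \<in> Hp_star" using pos by (simp add: Hp_star_def)
  then have "LRT n Hp_star x = fit ?S ?y ?y"
    using LRT_max_fit[OF spd closed_convex_cone_Hp_star] le by (metis antisym)
  also have "\<dots> = inner_wrt ?S ?y ?y"
    by (simp add: fit_def norm_wrt_power2[OF spd]) (simp add: inner_wrt_def)
  finally show ?thesis .
qed

text \<open>A translation of the sample keeps the scatter matrix and places the root mean anywhere.
  At \<open>t\<close> times the axis the statistic is a fixed positive number times the square of
  \<open>t\<close>, so it takes every positive value.\<close>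

lemma exists_LRT_Hp_star_eq:
  fixes x :: "nat \<Rightarrow> real^'p::{finite,linorder}"
  assumes spd: "scatter n x \<in> spd_matrices" and n: "0 < n" and r: "0 < r"
  obtains x' :: "nat \<Rightarrow> real^'p::{finite,linorder}" where "scatter n x' \<in> spd_matrices" "0 < root_mean n x' $ Max UNIV"
    "LRT n Hp_star x' = r"
proof -
  let ?S = "scatter n x" and ?e = "axis (Max UNIV) (1::real) :: real^'p::_"
  obtain B :: "real^'p::_^'p::_" where B: "invertible B" "B ** transpose B = ?S"
    using spd_factorization[OF spd] by blast
  define q where "q = inner_wrt ?S ?e ?e"
  have "matrix_inv B *v ?e \<noteq> 0"
    using B(1) by (metis axis_eq_0_iff matrix_inv_vector_cancel(1) matrix_vector_mult_0_right zero_neq_one)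
  then have q: "0 < q"
    using inner_wrt_factor[OF B(1), of ?e ?e] B(2) by (simp add: q_def)
  define t where "t = sqrt (r / q)"
  have t: "0 < t" "t * t * q = r"
    using r q by (simp_all add: t_def)
  \<comment> \<open>Translation by \<open>v\<close> moves the root mean by
    \<open>sqrt (real n)\<close> times \<open>v\<close>, which brings it exactly to \<open>t\<close>
    times \<open>?e\<close>.\<close>
  define v where "v = (1 / sqrt (real n)) *\<^sub>R (t *\<^sub>R ?e - root_mean n x)"
  define x' where "x' = (\<lambda>i. x i + v)"
  have S: "scatter n x' = ?S"
    unfolding x'_def using n by (rule scatter_translate)
  have y: "root_mean n x' = t *\<^sub>R ?e"
    using n by (simp add: root_mean_def x'_def sample_mean_translate v_def scaleR_add_right)
  show ?thesis
  proof
    show spd': "scatter n x' \<in> spd_matrices" using spd S by simp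
    show pos: "0 < root_mean n x' $ Max UNIV" using t by (simp add: y)
    have "LRT n Hp_star x' = t * t * q"
      unfolding LRT_Hp_star_self[OF spd' less_imp_le[OF pos]] S y
      by (simp add: inner_wrt_def q_def matrix_vector_mult_scaleR)
    then show "LRT n Hp_star x' = r" using t by simp
  qed
qed

text \<open>Some sample has a statistic strictly between \<open>a\<close> and \<open>b\<close> and a
  positive last mean coordinate. The region of such samples is open, so it contains a product box,
  which a normal sample hits with positive probability.\<close>

lemma prob_LRT_Hp_star_between_pos:
  fixes x :: "nat \<Rightarrow> real^'p::{finite,linorder}" and X :: "nat \<Rightarrow> 'a \<Rightarrow> real^'p::{finite,linorder}"
  assumes X: "iid_mvn M n X \<theta> \<Sigma>" and \<Sigma>: "\<Sigma> \<in> spd_matrices" and n: "0 < n"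
    and spd: "scatter n x \<in> spd_matrices" and ab: "0 < a" "a < b"
  shows "0 < \<P>(\<omega> in M. a < LRT n Hp_star (\<lambda>i. X i \<omega>) \<and> LRT n Hp_star (\<lambda>i. X i \<omega>) < b)"
proof -
  interpret prob_space M using X by (rule iid_mvn_prob_space)
  let ?m = "Max UNIV :: 'p"
  let ?q = "\<lambda>x. cramer_form (scatter n x) (root_mean n x)"
  let ?W = "{x :: nat \<Rightarrow> real^'p::_. det (scatter n x) \<noteq> 0 \<and> 0 < root_mean n x $ ?m \<and> a < ?q x \<and> ?q x < b}"
  have LRT_q: "LRT n Hp_star x = ?q x"
    if "det (scatter n x) \<noteq> 0" "0 < root_mean n x $ ?m" for x :: "nat \<Rightarrow> real^'p::_"
    using that LRT_Hp_star_self[of n x] scatter_spd_iff[of n x] inner_wrt_cramer by fastforce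
  obtain r where r: "a < r" "r < b" using ab dense by blast
  obtain x' :: "nat \<Rightarrow> real^'p::_" where x': "scatter n x' \<in> spd_matrices" "0 < root_mean n x' $ ?m"
    "LRT n Hp_star x' = r"
    using exists_LRT_Hp_star_eq[OF spd n, of r] ab r by auto
  then have "x' \<in> ?W"
    using LRT_q[of x'] r scatter_spd_iff[of n x'] by simp
  moreover have "openin (product_topology (\<lambda>_. euclidean) UNIV) ?W"
    using open_scatter_region[of n ?m a b] by (simp add: open_fun_def)
  ultimately obtain V where V: "x' \<in> (\<Pi>\<^sub>E i\<in>UNIV. V i)" "\<And>i. open (V i)" "(\<Pi>\<^sub>E i\<in>UNIV. V i) \<subseteq> ?W"
    using product_topology_open_contains_basis[of "\<lambda>_. euclidean" UNIV ?W x'] by auto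
  have x'V: "x' i \<in> V i" for i using V(1) by auto
  have "0 < prob (\<Inter>i\<in>{1..n}. X i -` V i \<inter> space M)"
    using V(2) x'V by (intro iid_mvn_open_pos[OF X \<Sigma> n]) blast
  also have "\<dots> \<le> \<P>(\<omega> in M. a < LRT n Hp_star (\<lambda>i. X i \<omega>) \<and> LRT n Hp_star (\<lambda>i. X i \<omega>) < b)"
  proof (rule finite_measure_mono)
    have [measurable]: "(\<lambda>\<omega>. LRT n Hp_star (\<lambda>i. X i \<omega>)) \<in> borel_measurable M"
      using iid_mvn_measurable[OF X] closed_convex_cone_Hp_star by (rule borel_measurable_LRT)
    show "{\<omega> \<in> space M. a < LRT n Hp_star (\<lambda>i. X i \<omega>) \<and> LRT n Hp_star (\<lambda>i. X i \<omega>) < b} \<in> sets M"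
      by measurable
    show "(\<Inter>i\<in>{1..n}. X i -` V i \<inter> space M)
      \<subseteq> {\<omega> \<in> space M. a < LRT n Hp_star (\<lambda>i. X i \<omega>) \<and> LRT n Hp_star (\<lambda>i. X i \<omega>) < b}"
    proof
      fix \<omega> assume \<omega>: "\<omega> \<in> (\<Inter>i\<in>{1..n}. X i -` V i \<inter> space M)"
      \<comment> \<open>The box constrains the whole sequence, the random sample only the indices up
        to \<open>n\<close>. The other entries are copied from \<open>x'\<close>, which is harmless
        because the statistic ignores them.\<close>
      define y where "y i = (if i \<in> {1..n} then X i \<omega> else x' i)" for i
      have "y i \<in> V i" for i
        using \<omega> x'V by (auto simp: y_def)
      then have "y \<in> ?W" using V(3) by auto
      then have "a < LRT n Hp_star y" "LRT n Hp_star y < b"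
        using LRT_q by auto
      moreover have "LRT n Hp_star y = LRT n Hp_star (\<lambda>i. X i \<omega>)"
        by (rule LRT_cong) (simp add: y_def)
      moreover have "\<omega> \<in> space M" using \<omega> n by auto
      ultimately show "\<omega> \<in> {\<omega> \<in> space M. a < LRT n Hp_star (\<lambda>i. X i \<omega>) \<and> LRT n Hp_star (\<lambda>i. X i \<omega>) < b}"
        by simp
    qed
  qed
  finally show ?thesis .
qed

text \<open>A factor of \<Sigma> that rescales the last coordinate by a positive constant maps the
  half-space to itself, so moving it into the cone changes nothing but the covariance.\<close>

lemma LRT_power_Hp_star_null:
  fixes P :: "real^'p::{finite,linorder} \<Rightarrow> real^'p::{finite,linorder}^'p::{finite,linorder} \<Rightarrow> 'a measure"
  assumes model: "\<And>\<theta> \<Sigma>. \<Sigma> \<in> spd_matrices \<Longrightarrow> iid_mvn (P \<theta> \<Sigma>) n X \<theta> \<Sigma>"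
    and n: "0 < n" and d: "0 < d" and \<Sigma>: "\<Sigma> \<in> spd_matrices"
  shows "LRT_power P n X Hp_star d 0 \<Sigma> = LRT_power P n X Hp_star d 0 (mat 1)"
proof -
  obtain B :: "real^'p::_^'p::_" and c where B: "invertible B" "B ** transpose B = \<Sigma>"
    and c: "0 < c" "\<And>x. (B *v x) $ Max UNIV = c * x $ Max UNIV"
    using spd_factorization[OF \<Sigma>, where m = "Max UNIV"] by blast
  have "(*v) B -` Hp_star = Hp_star"
    using c by (auto simp: Hp_star_def zero_le_mult_iff)
  then show ?thesis
    using LRT_power_linear[OF model B(1) n closed_convex_cone_Hp_star d] B(2) by simp
qed

lemma LRT_power_le_1:
  assumes "iid_mvn (P \<theta> \<Sigma>) n X \<theta> \<Sigma>"
  shows "LRT_power P n X C d \<theta> \<Sigma> \<le> 1"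
  using prob_space.prob_le_1[OF iid_mvn_prob_space[OF assms]] by (simp add: LRT_power_def)

lemma critical_value_le:
  fixes P :: "real^'p::{finite,linorder} \<Rightarrow> real^'p::{finite,linorder}^'p::{finite,linorder} \<Rightarrow> 'a measure"
  assumes model: "\<And>\<theta> \<Sigma>. \<Sigma> \<in> spd_matrices \<Longrightarrow> iid_mvn (P \<theta> \<Sigma>) n X \<theta> \<Sigma>"
    and n: "0 < n" and C: "closed_convex_cone C" "C \<subseteq> Hp_star"
    and U: "open U" "U \<noteq> {}" "U \<subseteq> C"
    and "0 < \<alpha>" and d: "0 < dC" "0 < dH"
    and level_C: "(SUP \<Sigma>\<in>spd_matrices. LRT_power P n X C dC 0 \<Sigma>) = \<alpha>"
    and level_H: "(SUP \<Sigma>\<in>spd_matrices. LRT_power P n X Hp_star dH 0 \<Sigma>) = \<alpha>"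
  shows "dH \<le> dC"
proof (rule ccontr)
  assume less: "\<not> dH \<le> dC"
  define M where "M = P 0 (mat 1)"
  have X: "iid_mvn M n X 0 (mat 1)"
    unfolding M_def by (rule model[OF mat_1_spd])
  interpret prob_space M using X by (rule iid_mvn_prob_space)
  define L where "L \<omega> = LRT n Hp_star (\<lambda>i. X i \<omega>)" for \<omega>
  have [measurable]: "L \<in> borel_measurable M"
    unfolding L_def using iid_mvn_measurable[OF X] closed_convex_cone_Hp_star
    by (rule borel_measurable_LRT)
  \<comment> \<open>The supremum runs over a constant family, so the level of the half-space test is
    its null probability at the identity covariance.\<close>
  have "(SUP \<Sigma>\<in>spd_matrices. LRT_power P n X Hp_star dH 0 \<Sigma>)
      = (SUP \<Sigma>\<in>(spd_matrices :: (real^'p::_^'p::_) set). LRT_power P n X Hp_star dH 0 (mat 1))"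
    by (intro SUP_cong refl LRT_power_Hp_star_null[OF model n d(2)])
  also have "\<dots> = \<P>(\<omega> in M. dH \<le> L \<omega>)"
    using mat_1_spd by (subst cSUP_const) (auto simp: LRT_power_def M_def L_def)
  finally have H: "\<P>(\<omega> in M. dH \<le> L \<omega>) = \<alpha>"
    using level_H by simp
  obtain u where u: "u \<in> U" using U(2) by blast
  have um: "0 < u $ Max UNIV"
    using open_subset_Hp_star_pos[OF U(1) u] U(3) C(2) by blast
  \<comment> \<open>A supremum of reals bounds the members of a family only if the family is bounded
    above.\<close>
  have bdd: "bdd_above ((\<lambda>\<Sigma>. LRT_power P n X C dC 0 \<Sigma>) ` spd_matrices)"
  proof (rule bdd_aboveI2)
    fix \<Sigma> :: "real^'p::_^'p::_"
    assume "\<Sigma> \<in> spd_matrices"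
    then show "LRT_power P n X C dC 0 \<Sigma> \<le> 1"
      using LRT_power_le_1[of P 0 \<Sigma> n X] model[of \<Sigma> 0] by blast
  qed
  have "\<P>(\<omega> in M. dC < L \<omega>) \<le> \<alpha>"
    unfolding L_def
  proof (rule prob_LRT_Hp_star_le[OF prob_space_axioms iid_mvn_measurable[OF X] C(1) U(1) u U(3) um d(1)])
    fix k
    let ?A = "matrix (squeeze u (Max UNIV) (1 / real (Suc k)))"
    have A: "invertible ?A"
      using um by (intro invertible_squeeze) auto
    \<comment> \<open>The k-th preimage of \<open>C\<close> at identity covariance corresponds to
      \<open>C\<close> itself at this covariance, where the level bounds the rejection
      probability.\<close>
    have "LRT_power P n X C dC 0 (?A ** transpose ?A) \<le> \<alpha>"
      unfolding level_C[symmetric] by (rule cSUP_upper[OF factor_spd[OF A] bdd])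
    then have "LRT_power P n X ((*v) ?A -` C) dC 0 (mat 1) \<le> \<alpha>"
      using LRT_power_linear[where P = P and X = X, OF model A n C(1) d(1)] by simp
    then show "\<P>(\<omega> in M. dC \<le> LRT n ((*v) ?A -` C) (\<lambda>i. X i \<omega>)) \<le> \<alpha>"
      by (simp add: LRT_power_def M_def)
  qed auto
  \<comment> \<open>The left side is at most \<alpha> and the last term equals \<alpha>, so the
    event between the critical values would have probability zero.\<close>
  moreover have "\<P>(\<omega> in M. dC < L \<omega>) = \<P>(\<omega> in M. dC < L \<omega> \<and> L \<omega> < dH) + \<P>(\<omega> in M. dH \<le> L \<omega>)"
  proof -
    have "{\<omega> \<in> space M. dC < L \<omega>} = {\<omega> \<in> space M. dC < L \<omega> \<and> L \<omega> < dH} \<union> {\<omega> \<in> space M. dH \<le> L \<omega>}"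
      using less by auto
    then show ?thesis
      by (simp only:) (rule finite_measure_Union, auto)
  qed
  moreover have "0 < \<P>(\<omega> in M. dC < L \<omega> \<and> L \<omega> < dH)"
  proof -
    \<comment> \<open>A sample with positive definite scatter matrix is wanted as a starting point;
      since \<alpha> is positive, the rejection event supplies one.\<close>
    have "{\<omega> \<in> space M. dH \<le> L \<omega>} \<noteq> {}"
      using H \<open>0 < \<alpha>\<close> by (metis less_irrefl measure_empty)
    then obtain \<omega> where "dH \<le> L \<omega>" by blast
    then have "scatter n (\<lambda>i. X i \<omega>) \<in> spd_matrices"
      using d(2) unfolding L_def by (intro LRT_pos_imp_spd[of n Hp_star]) simp
    then show ?thesis
      unfolding L_def
      by (rule prob_LRT_Hp_star_between_pos[OF X mat_1_spd n]) (use d less in auto)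
  qed
  ultimately show False using H by simp
qed

theorem proposition2p2:
  fixes P :: "real^'p::{finite,linorder} \<Rightarrow> real^'p::{finite,linorder}^'p::{finite,linorder} \<Rightarrow> 'a measure"
    and X :: "nat \<Rightarrow> 'a \<Rightarrow> real^'p::{finite,linorder}"
    and C U :: "(real^'p::{finite,linorder}) set"
    and n :: nat
    and \<alpha> d\<^sub>C d\<^sub>H :: real
  assumes "2 \<le> CARD('p)"
    and "CARD('p) < n"
    and model: "\<And>\<theta> \<Sigma>. \<Sigma> \<in> spd_matrices \<Longrightarrow> iid_mvn (P \<theta> \<Sigma>) n X \<theta> \<Sigma>"
    and "closed C" "convex C" "cone C"
    and "open U" "U \<noteq> {}" "U \<subseteq> C" "C \<subseteq> Hp_star"
    and "0 < \<alpha>" "\<alpha> < 1"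
    and "0 < d\<^sub>C" "0 < d\<^sub>H"
    and level_C: "(SUP \<Sigma>\<in>spd_matrices. LRT_power P n X C d\<^sub>C 0 \<Sigma>) = \<alpha>"
    and level_H: "(SUP \<Sigma>\<in>spd_matrices. LRT_power P n X Hp_star d\<^sub>H 0 \<Sigma>) = \<alpha>"
  shows "\<forall>\<theta>\<in>C - {0}. \<forall>\<Sigma>\<in>spd_matrices.
           LRT_power P n X C d\<^sub>C \<theta> \<Sigma> \<le> LRT_power P n X Hp_star d\<^sub>H \<theta> \<Sigma>"
proof (intro ballI)
  fix \<theta> :: "real^'p::_" and \<Sigma> :: "real^'p::_^'p::_"
  assume \<Sigma>: "\<Sigma> \<in> spd_matrices"
  have n: "0 < n" using \<open>CARD('p) < n\<close> by simp
  \<comment> \<open>\<open>cone\<close> admits the empty set; that \<open>C\<close> is nonempty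
    comes from \<open>U\<close>.\<close>
  have C: "closed_convex_cone C"
    using assms unfolding closed_convex_cone_def by blast
  have le: "d\<^sub>H \<le> d\<^sub>C"
    by (rule critical_value_le[OF model n C]) (use assms in auto)
  have X: "iid_mvn (P \<theta> \<Sigma>) n X \<theta> \<Sigma>"
    by (rule model[OF \<Sigma>])
  interpret prob_space "P \<theta> \<Sigma>" using X by (rule iid_mvn_prob_space)
  have [measurable]: "(\<lambda>\<omega>. LRT n Hp_star (\<lambda>i. X i \<omega>)) \<in> borel_measurable (P \<theta> \<Sigma>)"
    using iid_mvn_measurable[OF X] closed_convex_cone_Hp_star by (rule borel_measurable_LRT)
  show "LRT_power P n X C d\<^sub>C \<theta> \<Sigma> \<le> LRT_power P n X Hp_star d\<^sub>H \<theta> \<Sigma>"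
    unfolding LRT_power_def
  proof (rule finite_measure_mono)
    show "{\<omega> \<in> space (P \<theta> \<Sigma>). d\<^sub>C \<le> LRT n C (\<lambda>i. X i \<omega>)}
        \<subseteq> {\<omega> \<in> space (P \<theta> \<Sigma>). d\<^sub>H \<le> LRT n Hp_star (\<lambda>i. X i \<omega>)}"
      using LRT_mono[OF C closed_convex_cone_Hp_star \<open>C \<subseteq> Hp_star\<close> \<open>0 < d\<^sub>C\<close>] le by force
  qed measurable
qed

end
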